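(* Let $\chi>\beth_1$ be a cardinal and $\mathbb{P}=\mathrm{Add}(\omega,\chi)$. Then the following holds in $V^{\mathbb{P}}$: for any set $X\subseteq{^\omega}\omega$ containing at least $(\beth_1^+)^V$-many of the Cohen reals added by $\mathbb{P}$, every $1$-coherent family $\Phi=\langle\varphi_f\mid f\in X\rangle$ indexed by $X$ is $1$-trivial.
   Context: $\mathrm{Add}(\omega,\chi)$ is the poset of finite partial functions from $\chi\times\omega$ to $\omega$ ordered by reverse inclusion; a generic filter yields $F:\chi\times\omega\to\omega$, and $f_\alpha=F(\alpha,\cdot)$ is the $\alpha$-th Cohen real added. "$X$ contains at least $\kappa$-many of the Cohen reals" means $|\{\alpha<\chi\mid f_\alpha\in X\}|\geq\kappa$. For $f\in{^\omega}\omega$, $I(f)=\{(j,k)\in\omega^2\mid k\leq f(j)\}$; $f\wedge g$ is the pointwise minimum. A family $\langle\varphi_f:I(f)\to\mathbb{Z}\mid f\in X\rangle$ is $1$-coherent if for all $f,g\in X$, $\varphi_f$ and $\varphi_g$ differ at only finitely many points of $I(f\wedge g)$; it is $1$-trivial if there is $\psi:\omega^2\to\mathbb{Z}$ such that for each $f\in X$, $\psi$ and $\varphi_f$ differ at only finitely many points of $I(f)$. *)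

theory Defs
  imports Main "HOL-Library.Finite_Map"
begin

unbundle cardinal_syntax

section \<open>The poset \<open>Add(\<omega>,\<chi>)\<close>\<close>

text \<open>
  The ground model \<open>V\<close> is the universe of HOL.  A cardinal \<open>\<chi>\<close> is given by a type \<open>'c\<close> of that
  cardinality; the elements of \<open>'c\<close> play the role of the ordinals below \<open>\<chi>\<close>.
\<close>

type_synonym 'c cond = "('c \<times> nat, nat) fmap"

definition stronger :: "'c cond \<Rightarrow> 'c cond \<Rightarrow> bool" (infix "\<preceq>" 50) where
  "q \<preceq> p \<longleftrightarrow> p \<subseteq>\<^sub>f q"

abbreviation beth_1 :: "nat set rel" where
  "beth_1 \<equiv> |UNIV :: nat set set|"

section \<open>Names\<close>

text \<open>
  \<open>ground\<close> collects the elements of \<open>V\<close> that the formulas below refer to: natural numbers,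
  integers, ordinals below \<open>\<chi>\<close>, and elements of a set of size \<open>\<beth>\<^sub>1\<^sup>+\<close> (note that
  \<open>cardSuc beth_1\<close> is a well-order of sets of sets of natural numbers).
\<close>

datatype 'c ground = Nat nat | Integer int | Idx 'c | Ord "nat set set"

text \<open>
  \<open>P\<close>-names.  \<open>Coll e\<close> is the name whose elements are the pairs (name, condition) in \<open>ran e\<close>,
  as in the usual recursive definition of \<open>P\<close>-names.  A HOL type cannot contain all sets of its own
  elements, so the members of a name are indexed by a type: here \<open>'c + 'i\<close>, where \<open>'i\<close> is arbitrary.
  The names of type \<open>('c, 'i) name\<close> are those with hereditarily at most \<open>|'c + 'i|\<close> members, and a
  statement that is universally quantified over \<open>'i\<close> speaks about names of unbounded size.
  The summand \<open>'c\<close> makes sure that, whatever \<open>'i\<close> is, the small witnesses required by the existential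
  quantifiers below (functions with domain \<open>\<omega>\<^sup>2\<close>, injections of \<open>\<beth>\<^sub>1\<^sup>+\<close> into \<open>\<chi>\<close>, injections between
  subsets of countable sets) have names.

  To avoid a set-theoretic coding of numbers and pairs, the check name of a ground object and the
  name of an ordered pair are constructors instead of particular names \<open>Coll e\<close>.
\<close>

datatype ('c, 'i) name =
    Check "'c ground"
  | OPair "('c, 'i) name" "('c, 'i) name"
  | Coll "('c + 'i) \<Rightarrow> (('c, 'i) name \<times> 'c cond) option"

fun elems :: "('c, 'i) name \<Rightarrow> (('c, 'i) name \<times> 'c cond) set" where
  "elems (Coll e) = ran e"
| "elems _ = {}"

text \<open>
  The name with a given set of elements; meaningful for sets of cardinality at most \<open>|'c + 'i|\<close>,
  see \<open>elems_mkset\<close>.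
\<close>

definition mkset :: "(('c, 'i) name \<times> 'c cond) set \<Rightarrow> ('c, 'i) name" where
  "mkset S = Coll (SOME e. ran e = S)"

lemma elems_mkset:
  fixes S :: "(('c, 'i) name \<times> 'c cond) set"
  assumes "|S| \<le>o |UNIV :: ('c + 'i) set|"
  shows "elems (mkset S) = S"
proof -
  obtain f :: "('c, 'i) name \<times> 'c cond \<Rightarrow> 'c + 'i" where f: "inj_on f S"
    using assms by (auto simp: card_of_ordLeq[symmetric])
  define e where "e i = (if i \<in> f ` S then Some (inv_into S f i) else None)" for i
  have "ran e = S"
  proof (intro equalityI subsetI)
    fix x assume "x \<in> S"
    hence "e (f x) = Some x" using f by (simp add: e_def)
    thus "x \<in> ran e" by (rule ranI)
  qed (use f in \<open>auto simp: ran_def e_def split: if_splits\<close>)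
  hence "ran (SOME e :: 'c + 'i \<Rightarrow> _. ran e = S) = S"
    by (rule someI[where P = "\<lambda>e. ran e = S"])
  thus ?thesis by (simp add: mkset_def)
qed

section \<open>The forcing relation\<close>

text \<open>
  A formula of the forcing language (with names substituted for its free variables) is represented
  by the set of conditions that force it; \<open>\<phi> p\<close> reads \<open>p \<tturnstile> \<phi>\<close>.
\<close>

type_synonym 'c fm = "'c cond \<Rightarrow> bool"

definition dense_below :: "'c cond \<Rightarrow> 'c fm \<Rightarrow> bool" where
  "dense_below p D \<longleftrightarrow> (\<forall>q. q \<preceq> p \<longrightarrow> (\<exists>r. r \<preceq> q \<and> D r))"

lemma dense_below_mono [mono]:
  "(\<And>r. D r \<longrightarrow> E r) \<Longrightarrow> dense_below p D \<longrightarrow> dense_below p E"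
  by (fastforce simp: dense_below_def)

text \<open>
  Forced equality, by the usual recursion on names: for \<open>Coll e\<close> and \<open>Coll e'\<close> it says that every
  \<open>q \<preceq> p, s\<close> with \<open>(c, s)\<close> an element of one of the two names forces \<open>c\<close> to be a member of
  the other one.  The recursion is positive and names are well-founded, so it may be written as an
  inductive definition.  Equality of ground objects is decided in \<open>V\<close>.
\<close>

inductive forces_eq :: "('c, 'i) name \<Rightarrow> ('c, 'i) name \<Rightarrow> 'c fm" (infix "\<^bold>=" 50) where
  Check: "(Check a \<^bold>= Check a) p"
| OPair: "(x \<^bold>= x') p \<Longrightarrow> (y \<^bold>= y') p \<Longrightarrow> (OPair x y \<^bold>= OPair x' y') p"
| Coll: "(\<forall>c s q. (c, s) \<in> ran e \<longrightarrow> q \<preceq> p \<longrightarrow> q \<preceq> s \<longrightarrow>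
            dense_below q (\<lambda>r. \<exists>d t. (d, t) \<in> ran e' \<and> r \<preceq> t \<and> (c \<^bold>= d) r)) \<Longrightarrow>
         (\<forall>d t q. (d, t) \<in> ran e' \<longrightarrow> q \<preceq> p \<longrightarrow> q \<preceq> t \<longrightarrow>
            dense_below q (\<lambda>r. \<exists>c s. (c, s) \<in> ran e \<and> r \<preceq> s \<and> (c \<^bold>= d) r)) \<Longrightarrow>
         (Coll e \<^bold>= Coll e') p"

definition forces_mem :: "('c, 'i) name \<Rightarrow> ('c, 'i) name \<Rightarrow> 'c fm" (infix "\<^bold>\<in>" 50) where
  "(x \<^bold>\<in> y) p \<longleftrightarrow> dense_below p (\<lambda>q. \<exists>c s. (c, s) \<in> elems y \<and> q \<preceq> s \<and> (x \<^bold>= c) q)"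

definition forces_not :: "'c fm \<Rightarrow> 'c fm" ("\<^bold>\<not> _" [40] 40) where
  "(\<^bold>\<not> \<phi>) p \<longleftrightarrow> (\<forall>q. q \<preceq> p \<longrightarrow> \<not> \<phi> q)"

definition forces_and :: "'c fm \<Rightarrow> 'c fm \<Rightarrow> 'c fm" (infixr "\<^bold>\<and>" 35) where
  "(\<phi> \<^bold>\<and> \<psi>) p \<longleftrightarrow> \<phi> p \<and> \<psi> p"

definition forces_all :: "(('c, 'i) name \<Rightarrow> 'c fm) \<Rightarrow> 'c fm" (binder "\<^bold>\<forall>" 10) where
  "forces_all \<phi> p \<longleftrightarrow> (\<forall>x. \<phi> x p)"

abbreviation forces_or :: "'c fm \<Rightarrow> 'c fm \<Rightarrow> 'c fm" (infixr "\<^bold>\<or>" 30) where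
  "\<phi> \<^bold>\<or> \<psi> \<equiv> \<^bold>\<not> (\<^bold>\<not> \<phi> \<^bold>\<and> \<^bold>\<not> \<psi>)"

abbreviation forces_imp :: "'c fm \<Rightarrow> 'c fm \<Rightarrow> 'c fm" (infixr "\<^bold>\<longrightarrow>" 25) where
  "\<phi> \<^bold>\<longrightarrow> \<psi> \<equiv> \<^bold>\<not> (\<phi> \<^bold>\<and> \<^bold>\<not> \<psi>)"

abbreviation forces_iff :: "'c fm \<Rightarrow> 'c fm \<Rightarrow> 'c fm" (infixr "\<^bold>\<longleftrightarrow>" 25) where
  "\<phi> \<^bold>\<longleftrightarrow> \<psi> \<equiv> (\<phi> \<^bold>\<longrightarrow> \<psi>) \<^bold>\<and> (\<psi> \<^bold>\<longrightarrow> \<phi>)"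

abbreviation forces_ex :: "(('c, 'i) name \<Rightarrow> 'c fm) \<Rightarrow> 'c fm" (binder "\<^bold>\<exists>" 10) where
  "forces_ex \<phi> \<equiv> \<^bold>\<not> (\<^bold>\<forall>x. \<^bold>\<not> \<phi> x)"

text \<open>\<open>\<phi>\<close> holds in \<open>V\<^sup>P\<close>.\<close>

definition forced :: "'c fm \<Rightarrow> bool" ("\<tturnstile> _" [10] 10) where
  "(\<tturnstile> \<phi>) \<longleftrightarrow> (\<forall>p. \<phi> p)"

section \<open>Names for ground sets and for the generic function\<close>

definition check_set :: "'c ground set \<Rightarrow> ('c, 'i) name" where
  "check_set A = mkset ((\<lambda>a. (Check a, fmempty)) ` A)"

definition omega :: "('c, 'i) name" where
  "omega = check_set (range Nat)"

definition integers :: "('c, 'i) name" where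
  "integers = check_set (range Integer)"

definition chi :: "('c, 'i) name" where
  "chi = check_set (range Idx)"

text \<open>The check name of \<open>(\<beth>\<^sub>1\<^sup>+)\<^sup>V\<close>.\<close>

definition beth_1_plus :: "('c, 'i) name" where
  "beth_1_plus = check_set (Ord ` Field (cardSuc beth_1))"

text \<open>The check name of the ordering of the natural numbers.\<close>

definition le_rel :: "('c, 'i) name" where
  "le_rel = mkset {(OPair (Check (Nat k)) (Check (Nat m)), fmempty) | k m. k \<le> m}"

text \<open>
  The generic function \<open>F : \<chi> \<times> \<omega> \<rightarrow> \<omega>\<close>, i.e. the union of the generic filter: \<open>((\<alpha>, n), m)\<close> belongs
  to \<open>F\<close> iff some \<open>p\<close> in the generic filter satisfies \<open>p(\<alpha>, n) = m\<close>.
\<close>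

definition generic_fun :: "('c, 'i) name" where
  "generic_fun = mkset {(OPair (OPair (Check (Idx \<alpha>)) (Check (Nat n))) (Check (Nat m)), p)
                        | \<alpha> n m p. fmlookup p (\<alpha>, n) = Some m}"

section \<open>Formulas of the forcing language\<close>

text \<open>A class term \<open>{x. \<phi> x}\<close> of the forcing language.\<close>

type_synonym ('c, 'i) cls = "('c, 'i) name \<Rightarrow> 'c fm"

abbreviation set_cls :: "('c, 'i) name \<Rightarrow> ('c, 'i) cls" where
  "set_cls A \<equiv> \<lambda>x. x \<^bold>\<in> A"

definition univ_cls :: "('c, 'i) cls" where
  "univ_cls x = (x \<^bold>= x)"

definition ball :: "('c, 'i) cls \<Rightarrow> (('c, 'i) name \<Rightarrow> 'c fm) \<Rightarrow> 'c fm" where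
  "ball A \<phi> = (\<^bold>\<forall>x. A x \<^bold>\<longrightarrow> \<phi> x)"

definition bex :: "('c, 'i) cls \<Rightarrow> (('c, 'i) name \<Rightarrow> 'c fm) \<Rightarrow> 'c fm" where
  "bex A \<phi> = (\<^bold>\<exists>x. A x \<^bold>\<and> \<phi> x)"

syntax
  "_fm_ball" :: "pttrn \<Rightarrow> 'a \<Rightarrow> 'b \<Rightarrow> 'b" ("(3\<^bold>\<forall>_\<^bold>:_./ _)" [0, 0, 10] 10)
  "_fm_bex" :: "pttrn \<Rightarrow> 'a \<Rightarrow> 'b \<Rightarrow> 'b" ("(3\<^bold>\<exists>_\<^bold>:_./ _)" [0, 0, 10] 10)
translations
  "\<^bold>\<forall>x\<^bold>:A. \<phi>" \<rightleftharpoons> "CONST ball A (\<lambda>x. \<phi>)"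
  "\<^bold>\<exists>x\<^bold>:A. \<phi>" \<rightleftharpoons> "CONST bex A (\<lambda>x. \<phi>)"

abbreviation \<omega> :: "('c, 'i) cls" where
  "\<omega> \<equiv> set_cls omega"

abbreviation \<omega>2 :: "('c, 'i) cls" where
  "\<omega>2 \<equiv> \<lambda>z. \<^bold>\<exists>j\<^bold>:\<omega>. \<^bold>\<exists>k\<^bold>:\<omega>. z \<^bold>= OPair j k"

abbreviation \<Z> :: "('c, 'i) cls" where
  "\<Z> \<equiv> set_cls integers"

text \<open>\<open>g : A \<rightarrow> B\<close>.\<close>

definition is_fun :: "('c, 'i) name \<Rightarrow> ('c, 'i) cls \<Rightarrow> ('c, 'i) cls \<Rightarrow> 'c fm" where
  "is_fun g A B =
     ((\<^bold>\<forall>z\<^bold>:set_cls g. \<^bold>\<exists>a\<^bold>:A. \<^bold>\<exists>b\<^bold>:B. z \<^bold>= OPair a b) \<^bold>\<and>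
      (\<^bold>\<forall>a\<^bold>:A. \<^bold>\<exists>b\<^bold>:B. OPair a b \<^bold>\<in> g) \<^bold>\<and>
      (\<^bold>\<forall>a. \<^bold>\<forall>b. \<^bold>\<forall>b'. OPair a b \<^bold>\<in> g \<^bold>\<and> OPair a b' \<^bold>\<in> g \<^bold>\<longrightarrow> b \<^bold>= b'))"

text \<open>\<open>|A| \<le> |B|\<close>: there is an injection from \<open>A\<close> to \<open>B\<close>.\<close>

definition card_le :: "('c, 'i) cls \<Rightarrow> ('c, 'i) cls \<Rightarrow> 'c fm" where
  "card_le A B = (\<^bold>\<exists>g. is_fun g A B \<^bold>\<and>
     (\<^bold>\<forall>a. \<^bold>\<forall>a'. \<^bold>\<forall>b. OPair a b \<^bold>\<in> g \<^bold>\<and> OPair a' b \<^bold>\<in> g \<^bold>\<longrightarrow> a \<^bold>= a'))"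

definition fm_le :: "('c, 'i) name \<Rightarrow> ('c, 'i) name \<Rightarrow> 'c fm" (infix "\<^bold>\<le>" 50) where
  "(k \<^bold>\<le> m) = (OPair k m \<^bold>\<in> le_rel)"

text \<open>\<open>A\<close> injects into \<open>{0, \<dots>, n - 1}\<close> for some \<open>n \<in> \<omega>\<close>.\<close>

definition fm_finite :: "('c, 'i) cls \<Rightarrow> 'c fm" where
  "fm_finite A = (\<^bold>\<exists>n\<^bold>:\<omega>. card_le A (\<lambda>m. m \<^bold>\<in> omega \<^bold>\<and> m \<^bold>\<le> n \<^bold>\<and> \<^bold>\<not> (m \<^bold>= n)))"

text \<open>
  \<open>graph f j m\<close> is \<open>f(j) = m\<close>.  Since \<open>f \<and> g\<close> is defined from \<open>f\<close> and \<open>g\<close>, functions from \<open>\<omega>\<close> to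
  \<open>\<omega>\<close> enter \<open>I\<close> through their (definable) graphs.
\<close>

definition graph :: "('c, 'i) name \<Rightarrow> ('c, 'i) name \<Rightarrow> ('c, 'i) name \<Rightarrow> 'c fm" where
  "graph f j m = (OPair j m \<^bold>\<in> f)"

definition meet :: "(('c, 'i) name \<Rightarrow> ('c, 'i) name \<Rightarrow> 'c fm) \<Rightarrow>
    (('c, 'i) name \<Rightarrow> ('c, 'i) name \<Rightarrow> 'c fm) \<Rightarrow> ('c, 'i) name \<Rightarrow> ('c, 'i) name \<Rightarrow> 'c fm" where
  "meet f g j m = (\<^bold>\<exists>a. \<^bold>\<exists>b. f j a \<^bold>\<and> g j b \<^bold>\<and> ((a \<^bold>\<le> b \<^bold>\<and> m \<^bold>= a) \<^bold>\<or> (b \<^bold>\<le> a \<^bold>\<and> m \<^bold>= b)))"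

definition I :: "(('c, 'i) name \<Rightarrow> ('c, 'i) name \<Rightarrow> 'c fm) \<Rightarrow> ('c, 'i) cls" where
  "I f z = (\<^bold>\<exists>j\<^bold>:\<omega>. \<^bold>\<exists>k\<^bold>:\<omega>. z \<^bold>= OPair j k \<^bold>\<and> (\<^bold>\<exists>m. f j m \<^bold>\<and> k \<^bold>\<le> m))"

text \<open>\<open>\<phi>(z) \<noteq> \<gamma>(z)\<close>.\<close>

definition differ_at :: "('c, 'i) name \<Rightarrow> ('c, 'i) name \<Rightarrow> ('c, 'i) name \<Rightarrow> 'c fm" where
  "differ_at \<phi> \<gamma> z = (\<^bold>\<exists>v. \<^bold>\<exists>w. OPair z v \<^bold>\<in> \<phi> \<^bold>\<and> OPair z w \<^bold>\<in> \<gamma> \<^bold>\<and> \<^bold>\<not> (v \<^bold>= w))"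

text \<open>\<open>X \<subseteq> \<^sup>\<omega>\<omega>\<close>.\<close>

definition set_of_reals :: "('c, 'i) name \<Rightarrow> 'c fm" where
  "set_of_reals X = (\<^bold>\<forall>f\<^bold>:set_cls X. is_fun f \<omega> \<omega>)"

text \<open>\<open>f\<close> is the Cohen real \<open>f\<^sub>\<alpha> = F(\<alpha>, \<cdot>)\<close>.\<close>

definition is_cohen_real :: "('c, 'i) name \<Rightarrow> ('c, 'i) name \<Rightarrow> 'c fm" where
  "is_cohen_real \<alpha> f = (\<^bold>\<forall>z. z \<^bold>\<in> f \<^bold>\<longleftrightarrow>
     (\<^bold>\<exists>j\<^bold>:\<omega>. \<^bold>\<exists>m\<^bold>:\<omega>. z \<^bold>= OPair j m \<^bold>\<and> OPair (OPair \<alpha> j) m \<^bold>\<in> generic_fun))"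

text \<open>\<open>|{\<alpha> < \<chi>. f\<^sub>\<alpha> \<in> X}| \<ge> \<kappa>\<close>.\<close>

definition contains_cohen_reals :: "('c, 'i) name \<Rightarrow> ('c, 'i) name \<Rightarrow> 'c fm" where
  "contains_cohen_reals X \<kappa> =
     card_le (set_cls \<kappa>) (\<lambda>\<alpha>. \<alpha> \<^bold>\<in> chi \<^bold>\<and> (\<^bold>\<exists>f\<^bold>:set_cls X. is_cohen_real \<alpha> f))"

text \<open>\<open>\<Phi> = \<langle>\<phi>\<^sub>f : I(f) \<rightarrow> \<int> | f \<in> X\<rangle>\<close>, where \<open>\<phi>\<^sub>f\<close> is the \<open>\<phi>\<close> with \<open>(f, \<phi>) \<in> \<Phi>\<close>.\<close>

definition is_family :: "('c, 'i) name \<Rightarrow> ('c, 'i) name \<Rightarrow> 'c fm" where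
  "is_family \<Phi> X = (is_fun \<Phi> (set_cls X) univ_cls \<^bold>\<and>
     (\<^bold>\<forall>f\<^bold>:set_cls X. \<^bold>\<forall>\<phi>. OPair f \<phi> \<^bold>\<in> \<Phi> \<^bold>\<longrightarrow> is_fun \<phi> (I (graph f)) \<Z>))"

definition coherent_1 :: "('c, 'i) name \<Rightarrow> ('c, 'i) name \<Rightarrow> 'c fm" where
  "coherent_1 \<Phi> X = (\<^bold>\<forall>f\<^bold>:set_cls X. \<^bold>\<forall>g\<^bold>:set_cls X. \<^bold>\<forall>\<phi>. \<^bold>\<forall>\<gamma>.
     OPair f \<phi> \<^bold>\<in> \<Phi> \<^bold>\<and> OPair g \<gamma> \<^bold>\<in> \<Phi> \<^bold>\<longrightarrow>
     fm_finite (\<lambda>z. I (meet (graph f) (graph g)) z \<^bold>\<and> differ_at \<phi> \<gamma> z))"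

definition trivial_1 :: "('c, 'i) name \<Rightarrow> ('c, 'i) name \<Rightarrow> 'c fm" where
  "trivial_1 \<Phi> X = (\<^bold>\<exists>\<psi>. is_fun \<psi> \<omega>2 \<Z> \<^bold>\<and>
     (\<^bold>\<forall>f\<^bold>:set_cls X. \<^bold>\<forall>\<phi>. OPair f \<phi> \<^bold>\<in> \<Phi> \<^bold>\<longrightarrow>
        fm_finite (\<lambda>z. I (graph f) z \<^bold>\<and> differ_at \<psi> \<phi> z)))"

end

theory Submission
  imports Defs "HOL-Library.Countable_Set"
begin

text \<open>
  Let \<open>\<alpha>\<^sub>\<xi>\<close> (\<open>\<xi> < \<beth>\<^sub>1\<^sup>+\<close>) be indices such that some condition \<open>q\<^sub>\<xi>\<close> puts the Cohen real \<open>f\<^sub>\<xi>\<close> with index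
  \<open>\<alpha>\<^sub>\<xi>\<close> into \<open>X\<close>, and let \<open>\<phi>\<^sub>\<xi>\<close> be the corresponding member of the family. The values of \<open>\<phi>\<^sub>\<xi>\<close> are
  decided by conditions with support in a countable set, and there are at most \<open>\<beth>\<^sub>1\<close> isomorphism types
  of such names; so for some root \<open>\<rho>\<close> there are, away from any countable set, indices \<open>\<xi>\<close> of the same
  type whose supports meet in \<open>\<rho>\<close>. Take two of them, \<open>\<xi>\<close> and \<open>\<eta>\<close>, and a condition below \<open>q\<^sub>\<xi>\<close> and \<open>q\<^sub>\<eta>\<close>
  that bounds the disagreement of \<open>\<phi>\<^sub>\<xi>\<close> and \<open>\<phi>\<^sub>\<eta>\<close>. Two conditions that give different values to
  \<open>\<phi>\<^sub>\<xi>(j,k)\<close> but have compatible restrictions to \<open>\<rho>\<close> could be amalgamated after moving one of them to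
  the support of \<open>\<eta>\<close>; hence beyond the bound \<open>\<phi>\<^sub>\<xi>(j,k)\<close> depends on \<open>\<rho>\<close> only. The function \<open>\<psi>\<close>
  obtained in this way agrees almost everywhere with \<open>\<phi>\<^sub>\<xi>\<close> for uncountably many \<open>\<xi>\<close> of that type.

  If \<open>\<psi>\<close> differed from some \<open>\<phi>\<^sub>g\<close> infinitely often on \<open>I(g)\<close>, then this would be decided by conditions
  with support in a countable set \<open>u\<close>. For \<open>\<alpha>\<^sub>\<xi> \<notin> u\<close> the Cohen real \<open>f\<^sub>\<xi>\<close> lies above infinitely many of
  these points by genericity, which contradicts the coherence of \<open>\<phi>\<^sub>g\<close> and \<open>\<phi>\<^sub>\<xi>\<close>.
\<close>

section \<open>The forcing relation\<close>

lemma stronger_iff: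
  "q \<preceq> p \<longleftrightarrow> (\<forall>a n y. fmlookup p (a, n) = Some y \<longrightarrow> fmlookup q (a, n) = Some y)"
  by (simp add: stronger_def fmsubset_alt_def fmpred_iff)

lemma stronger_refl [simp, intro!]: "p \<preceq> p"
  by (simp add: stronger_iff)

lemma stronger_trans [trans]: "r \<preceq> q \<Longrightarrow> q \<preceq> p \<Longrightarrow> r \<preceq> p"
  by (simp add: stronger_iff)

lemma stronger_fmempty [simp]: "p \<preceq> fmempty"
  by (simp add: stronger_iff)

lemma strongerD: "q \<preceq> p \<Longrightarrow> fmlookup p x = Some y \<Longrightarrow> fmlookup q x = Some y"
  by (cases x) (simp add: stronger_iff)

lemma stronger_fmupd: "fmlookup p x = None \<Longrightarrow> fmupd x y p \<preceq> p"
  by (auto simp: stronger_iff)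

lemma dense_belowI: "(\<And>q. q \<preceq> p \<Longrightarrow> \<exists>r. r \<preceq> q \<and> D r) \<Longrightarrow> dense_below p D"
  by (simp add: dense_below_def)

lemma dense_belowE:
  assumes "dense_below p D"
  obtains r where "r \<preceq> p" "D r"
  using assms stronger_refl by (auto simp: dense_below_def)

lemma dense_below_stronger: "dense_below p D \<Longrightarrow> q \<preceq> p \<Longrightarrow> dense_below q D"
  using stronger_trans unfolding dense_below_def by blast

lemma dense_belowI': "(\<And>q. q \<preceq> p \<Longrightarrow> D q) \<Longrightarrow> dense_below p D"
  unfolding dense_below_def by blast

lemma dense_below_weaken: "dense_below p D \<Longrightarrow> (\<And>q. q \<preceq> p \<Longrightarrow> D q \<Longrightarrow> E q) \<Longrightarrow> dense_below p E"
  unfolding dense_below_def by (meson stronger_trans)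

lemma dense_below_dense_below: "dense_below p (\<lambda>q. dense_below q D) \<Longrightarrow> dense_below p D"
  unfolding dense_below_def by (meson stronger_refl stronger_trans)

text \<open>A formula is an arbitrary set of conditions here, so persistence under strengthening has
  to be checked formula by formula.\<close>

definition mono_fm :: "'c fm \<Rightarrow> bool" where
  "mono_fm \<phi> \<longleftrightarrow> (\<forall>p q. \<phi> p \<longrightarrow> q \<preceq> p \<longrightarrow> \<phi> q)"

lemma mono_fmD: "mono_fm \<phi> \<Longrightarrow> \<phi> p \<Longrightarrow> q \<preceq> p \<Longrightarrow> \<phi> q"
  by (auto simp: mono_fm_def)

lemma forces_eq_stronger: "(x \<^bold>= y) p \<Longrightarrow> q \<preceq> p \<Longrightarrow> (x \<^bold>= y) q"
proof (induction arbitrary: q rule: forces_eq.induct)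
  case (Coll e p e')
  show ?case
  proof (intro forces_eq.Coll allI impI)
    fix c s q' assume "(c, s) \<in> ran e" "q' \<preceq> q" "q' \<preceq> s"
    thus "dense_below q' (\<lambda>r. \<exists>d t. (d, t) \<in> ran e' \<and> r \<preceq> t \<and> (c \<^bold>= d) r)"
      using Coll by (blast intro: dense_below_weaken stronger_trans)
  next
    fix d t q' assume "(d, t) \<in> ran e'" "q' \<preceq> q" "q' \<preceq> t"
    thus "dense_below q' (\<lambda>r. \<exists>c s. (c, s) \<in> ran e \<and> r \<preceq> s \<and> (c \<^bold>= d) r)"
      using Coll by (blast intro: dense_below_weaken stronger_trans)
  qed
qed (auto intro: forces_eq.intros)

lemma OPair_eq_OPair [simp]: "(OPair x y \<^bold>= OPair x' y') p \<longleftrightarrow> (x \<^bold>= x') p \<and> (y \<^bold>= y') p"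
  by (auto intro: forces_eq.intros elim: forces_eq.cases)

lemma OPair_eqE:
  assumes "(OPair x y \<^bold>= z) p"
  obtains x' y' where "z = OPair x' y'" "(x \<^bold>= x') p" "(y \<^bold>= y') p"
  using assms by (cases rule: forces_eq.cases) auto

lemma Check_eqE: "(Check a \<^bold>= z) p \<Longrightarrow> z = Check a"
  by (auto elim: forces_eq.cases)

lemma forces_eq_refl [simp, intro!]: "(x \<^bold>= x) p"
proof (induction x arbitrary: p)
  case (Coll e)
  have "(c \<^bold>= c) r" if "(c, s) \<in> ran e" for c s r
  proof -
    from that obtain i where "e i = Some (c, s)" by (auto simp: ran_def)
    thus ?thesis using Coll[OF rangeI[of e i], of "(c, s)"] by auto
  qed
  thus ?case
    by (intro forces_eq.Coll allI impI dense_belowI') (meson stronger_trans)+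
qed (auto intro: forces_eq.intros)

lemma forces_eq_sym: "(x \<^bold>= y) p \<Longrightarrow> (y \<^bold>= x) p"
proof (induction rule: forces_eq.induct)
  case (Coll e p e')
  show ?case
  proof (intro forces_eq.Coll allI impI)
    fix d t q assume "(d, t) \<in> ran e'" "q \<preceq> p" "q \<preceq> t"
    thus "dense_below q (\<lambda>r. \<exists>c s. (c, s) \<in> ran e \<and> r \<preceq> s \<and> (d \<^bold>= c) r)"
      using Coll(2) by (blast intro: dense_below_weaken)
  next
    fix c s q assume "(c, s) \<in> ran e" "q \<preceq> p" "q \<preceq> s"
    thus "dense_below q (\<lambda>r. \<exists>d t. (d, t) \<in> ran e' \<and> r \<preceq> t \<and> (d \<^bold>= c) r)"
      using Coll(1) by (blast intro: dense_below_weaken)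
  qed
qed (auto intro: forces_eq.intros)

lemma eq_Check_iff [simp]:
  "(Check a \<^bold>= z) p \<longleftrightarrow> z = Check a" "(z \<^bold>= Check a) p \<longleftrightarrow> z = Check a"
  using forces_eq_sym by (auto dest!: Check_eqE)

lemma eq_OPair_iff:
  "(z \<^bold>= OPair x y) p \<longleftrightarrow> (\<exists>x' y'. z = OPair x' y' \<and> (x' \<^bold>= x) p \<and> (y' \<^bold>= y) p)"
  by (auto dest: forces_eq_sym elim: OPair_eqE) (meson OPair_eqE forces_eq_sym)

lemma forces_mem_stronger: "(x \<^bold>\<in> y) p \<Longrightarrow> q \<preceq> p \<Longrightarrow> (x \<^bold>\<in> y) q"
  by (simp add: forces_mem_def dense_below_stronger)

lemma forces_memI: "(c, s) \<in> elems y \<Longrightarrow> p \<preceq> s \<Longrightarrow> (x \<^bold>= c) p \<Longrightarrow> (x \<^bold>\<in> y) p"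
  unfolding forces_mem_def by (rule dense_belowI') (meson forces_eq_stronger stronger_trans)

lemma forces_not_stronger: "(\<^bold>\<not> \<phi>) p \<Longrightarrow> q \<preceq> p \<Longrightarrow> (\<^bold>\<not> \<phi>) q"
  unfolding forces_not_def by (meson stronger_trans)

text \<open>The existential quantifier is a double negation, so it asks for witnesses on a dense set
  only. Hence each choice of a witness below passes to a stronger condition.\<close>

lemma forces_ex_iff: "(\<^bold>\<exists>x. \<phi> x) p \<longleftrightarrow> dense_below p (\<lambda>q. \<exists>x. \<phi> x q)"
  unfolding forces_not_def dense_below_def forces_all_def by blast

lemma forces_imp_iff: "(\<phi> \<^bold>\<longrightarrow> \<psi>) p \<longleftrightarrow> (\<forall>q. q \<preceq> p \<longrightarrow> \<phi> q \<longrightarrow> (\<exists>r. r \<preceq> q \<and> \<psi> r))"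
  by (auto simp: forces_not_def forces_and_def)

lemma forces_impI: "(\<And>q. q \<preceq> p \<Longrightarrow> \<phi> q \<Longrightarrow> \<psi> q) \<Longrightarrow> (\<phi> \<^bold>\<longrightarrow> \<psi>) p"
  unfolding forces_imp_iff by (meson stronger_refl)

lemma forces_impD: "(\<phi> \<^bold>\<longrightarrow> \<psi>) p \<Longrightarrow> q \<preceq> p \<Longrightarrow> \<phi> q \<Longrightarrow> \<exists>r. r \<preceq> q \<and> \<psi> r"
  by (simp add: forces_imp_iff)

lemma ball_iff: "(\<^bold>\<forall>x\<^bold>:A. \<phi> x) p \<longleftrightarrow> (\<forall>x q. q \<preceq> p \<longrightarrow> A x q \<longrightarrow> (\<exists>r. r \<preceq> q \<and> \<phi> x r))"
  unfolding ball_def forces_all_def forces_imp_iff by blast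

lemma forces_ballI: "(\<And>x q. q \<preceq> p \<Longrightarrow> A x q \<Longrightarrow> \<phi> x q) \<Longrightarrow> (\<^bold>\<forall>x\<^bold>:A. \<phi> x) p"
  unfolding ball_iff by (meson stronger_refl)

lemma bex_iff: "(\<^bold>\<exists>x\<^bold>:A. \<phi> x) p \<longleftrightarrow> dense_below p (\<lambda>q. \<exists>x. A x q \<and> \<phi> x q)"
  by (simp add: bex_def forces_ex_iff forces_and_def)

lemma forces_or_iff: "(\<phi> \<^bold>\<or> \<psi>) p \<longleftrightarrow> dense_below p (\<lambda>q. \<phi> q \<or> \<psi> q)"
  unfolding forces_not_def dense_below_def forces_and_def by (meson stronger_refl stronger_trans)

section \<open>Persistence of forced formulas under stronger conditions\<close>

named_theorems mono_fms

lemma mono_fm_eq [mono_fms]: "mono_fm (x \<^bold>= y)"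
  by (auto simp: mono_fm_def intro: forces_eq_stronger)

lemma mono_fm_mem [mono_fms]: "mono_fm (x \<^bold>\<in> y)"
  by (auto simp: mono_fm_def intro: forces_mem_stronger)

lemma mono_fm_not [mono_fms]: "mono_fm (\<^bold>\<not> \<phi>)"
  by (auto simp: mono_fm_def intro: forces_not_stronger)

lemma mono_fm_and [mono_fms]: "mono_fm \<phi> \<Longrightarrow> mono_fm \<psi> \<Longrightarrow> mono_fm (\<phi> \<^bold>\<and> \<psi>)"
  by (auto simp: mono_fm_def forces_and_def)

lemma mono_fm_all [mono_fms]: "(\<And>x. mono_fm (\<phi> x)) \<Longrightarrow> mono_fm (\<^bold>\<forall>x. \<phi> x)"
  by (auto simp: mono_fm_def forces_all_def)

text \<open>Implications and existential quantifiers are negations, and a negation persists whatever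
  formula it is applied to.\<close>

lemma mono_fm_ball [mono_fms]: "mono_fm (\<^bold>\<forall>x\<^bold>:A. \<phi> x)"
  unfolding ball_def by (intro mono_fms)

lemma mono_fm_bex [mono_fms]: "mono_fm (\<^bold>\<exists>x\<^bold>:A. \<phi> x)"
  unfolding bex_def by (intro mono_fms)

lemma mono_fm_is_fun [mono_fms]: "mono_fm (is_fun g A B)"
  unfolding is_fun_def by (intro mono_fms)

lemma
  shows mono_fm_card_le [mono_fms]: "mono_fm (card_le A B)"
    and mono_fm_fm_le [mono_fms]: "mono_fm (k \<^bold>\<le> m)"
    and mono_fm_graph [mono_fms]: "mono_fm (graph f j m)"
    and mono_fm_meet [mono_fms]: "mono_fm (meet F G j m)"
    and mono_fm_I [mono_fms]: "mono_fm (I F z)"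
    and mono_fm_differ_at [mono_fms]: "mono_fm (differ_at \<phi> \<gamma> z)"
    and mono_fm_set_of_reals [mono_fms]: "mono_fm (set_of_reals X)"
    and mono_fm_is_cohen_real [mono_fms]: "mono_fm (is_cohen_real \<alpha> f)"
    and mono_fm_contains_cohen_reals [mono_fms]: "mono_fm (contains_cohen_reals X \<kappa>)"
    and mono_fm_is_family [mono_fms]: "mono_fm (is_family \<Phi> X)"
    and mono_fm_coherent_1 [mono_fms]: "mono_fm (coherent_1 \<Phi> X)"
  unfolding card_le_def fm_le_def graph_def meet_def I_def differ_at_def set_of_reals_def
    is_cohen_real_def contains_cohen_reals_def is_family_def coherent_1_def
  by (intro mono_fms)+

section \<open>Witnesses, functions and injections in the extension\<close>

lemma forces_exE:
  assumes "(\<^bold>\<exists>x. \<phi> x) p"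
  obtains r x where "r \<preceq> p" "\<phi> x r"
  using assms stronger_refl[of p] that unfolding forces_ex_iff dense_below_def by blast

lemma forces_exI: "\<phi> x p \<Longrightarrow> mono_fm (\<phi> x) \<Longrightarrow> (\<^bold>\<exists>x. \<phi> x) p"
  unfolding forces_ex_iff by (rule dense_belowI') (blast dest: mono_fmD)

lemma forces_bexE:
  assumes "(\<^bold>\<exists>x\<^bold>:A. \<phi> x) p"
  obtains r x where "r \<preceq> p" "A x r" "\<phi> x r"
  using assms stronger_refl[of p] that unfolding bex_iff dense_below_def by blast

lemma forces_bexI: "A x p \<Longrightarrow> \<phi> x p \<Longrightarrow> mono_fm (A x) \<Longrightarrow> mono_fm (\<phi> x) \<Longrightarrow> (\<^bold>\<exists>x\<^bold>:A. \<phi> x) p"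
  unfolding bex_iff by (rule dense_belowI') (blast dest: mono_fmD)

lemma is_fun_totalE:
  assumes "is_fun g A B p" "A a p"
  obtains r b where "r \<preceq> p" "B b r" "(OPair a b \<^bold>\<in> g) r"
proof -
  have "(\<^bold>\<forall>a\<^bold>:A. \<^bold>\<exists>b\<^bold>:B. OPair a b \<^bold>\<in> g) p"
    using assms(1) by (simp add: is_fun_def forces_and_def)
  then obtain q where q: "q \<preceq> p" "(\<^bold>\<exists>b\<^bold>:B. OPair a b \<^bold>\<in> g) q"
    using assms(2) unfolding ball_iff by (meson stronger_refl)
  obtain r b where "r \<preceq> q" "B b r" "(OPair a b \<^bold>\<in> g) r"
    by (rule forces_bexE[OF q(2)])
  thus thesis using that q(1) stronger_trans by blast
qed

lemma is_fun_uniqueE: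
  assumes "is_fun g A B p" "(OPair a b \<^bold>\<in> g) p" "(OPair a b' \<^bold>\<in> g) p"
  obtains r where "r \<preceq> p" "(b \<^bold>= b') r"
proof -
  have "(\<^bold>\<forall>a. \<^bold>\<forall>b. \<^bold>\<forall>b'. OPair a b \<^bold>\<in> g \<^bold>\<and> OPair a b' \<^bold>\<in> g \<^bold>\<longrightarrow> b \<^bold>= b') p"
    using assms(1) by (simp add: is_fun_def forces_and_def)
  hence "(OPair a b \<^bold>\<in> g \<^bold>\<and> OPair a b' \<^bold>\<in> g \<^bold>\<longrightarrow> b \<^bold>= b') p"
    by (simp add: forces_all_def)
  from forces_impD[OF this stronger_refl] show thesis
    using assms(2,3) that by (auto simp: forces_and_def)
qed

text \<open>Each clause of \<open>is_fun\<close> asks for witnesses on a dense set only, so it may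
  be checked after strengthening. Persistence of \<open>A\<close> and \<open>B\<close> turns a
  witness at a condition into a forced existential statement.\<close>

lemma is_funI:
  assumes "\<And>z q. q \<preceq> p \<Longrightarrow> (z \<^bold>\<in> g) q \<Longrightarrow> dense_below q (\<lambda>r. \<exists>a b. A a r \<and> B b r \<and> (z \<^bold>= OPair a b) r)"
    and "\<And>a q. q \<preceq> p \<Longrightarrow> A a q \<Longrightarrow> dense_below q (\<lambda>r. \<exists>b. B b r \<and> (OPair a b \<^bold>\<in> g) r)"
    and "\<And>a b b' q. q \<preceq> p \<Longrightarrow> (OPair a b \<^bold>\<in> g) q \<Longrightarrow> (OPair a b' \<^bold>\<in> g) q \<Longrightarrow> \<exists>r. r \<preceq> q \<and> (b \<^bold>= b') r"
    and mono: "\<And>a. mono_fm (A a)" "\<And>b. mono_fm (B b)"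
  shows "is_fun g A B p"
proof -
  have "(\<^bold>\<exists>a\<^bold>:A. \<^bold>\<exists>b\<^bold>:B. z \<^bold>= OPair a b) q" if "q \<preceq> p" "(z \<^bold>\<in> g) q" for z q
    unfolding bex_iff[of A] using assms(1)[OF that]
    by (rule dense_below_weaken) (auto intro!: forces_bexI mono_fms mono)
  moreover have "(\<^bold>\<exists>b\<^bold>:B. OPair a b \<^bold>\<in> g) q" if "q \<preceq> p" "A a q" for a q
    using assms(2)[OF that] by (simp add: bex_iff)
  moreover have "(OPair a b \<^bold>\<in> g \<^bold>\<and> OPair a b' \<^bold>\<in> g \<^bold>\<longrightarrow> b \<^bold>= b') p" for a b b'
    using assms(3) by (auto simp: forces_imp_iff forces_and_def)
  ultimately show ?thesis
    unfolding is_fun_def forces_and_def forces_all_def by (auto intro!: forces_ballI)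
qed

lemma card_leE:
  assumes "card_le A B p"
  obtains q g where "q \<preceq> p" "is_fun g A B q"
    "\<And>r a a' b. r \<preceq> q \<Longrightarrow> (OPair a b \<^bold>\<in> g) r \<Longrightarrow> (OPair a' b \<^bold>\<in> g) r \<Longrightarrow> \<exists>s. s \<preceq> r \<and> (a \<^bold>= a') s"
proof -
  obtain q g where q: "q \<preceq> p" "(is_fun g A B \<^bold>\<and>
     (\<^bold>\<forall>a. \<^bold>\<forall>a'. \<^bold>\<forall>b. OPair a b \<^bold>\<in> g \<^bold>\<and> OPair a' b \<^bold>\<in> g \<^bold>\<longrightarrow> a \<^bold>= a')) q"
    by (rule forces_exE[OF assms[unfolded card_le_def]])
  hence "(OPair a b \<^bold>\<in> g \<^bold>\<and> OPair a' b \<^bold>\<in> g \<^bold>\<longrightarrow> a \<^bold>= a') q" for a a' b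
    by (simp add: forces_and_def forces_all_def)
  hence "\<exists>s. s \<preceq> r \<and> (a \<^bold>= a') s"
    if "r \<preceq> q" "(OPair a b \<^bold>\<in> g) r" "(OPair a' b \<^bold>\<in> g) r" for r a a' b
    using that unfolding forces_imp_iff forces_and_def by blast
  thus thesis using that q by (auto simp: forces_and_def)
qed

lemma card_of_Times_le:
  assumes "infinite C" "|A| \<le>o |C|" "|B| \<le>o |C|"
  shows "|A \<times> B| \<le>o |C|"
  using assms card_of_Times_ordLeq_infinite_Field[of "|C|" A B]
  by (simp add: Field_card_of card_of_card_order_on)

section \<open>Restricting and relabelling conditions\<close>

text \<open>Compatibility in the poset: in this case \<open>p ++\<^sub>f q\<close> is a common
  extension.\<close>

definition compat :: "'c cond \<Rightarrow> 'c cond \<Rightarrow> bool" where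
  "compat p q \<longleftrightarrow> (\<forall>a n y z. fmlookup p (a, n) = Some y \<longrightarrow> fmlookup q (a, n) = Some z \<longrightarrow> y = z)"

lemma fmadd_stronger2: "p ++\<^sub>f q \<preceq> q"
  by (auto simp: stronger_iff fmdomI)

lemma fmadd_stronger1: "compat p q \<Longrightarrow> p ++\<^sub>f q \<preceq> p"
  by (auto simp: stronger_iff compat_def fmlookup_dom_iff)

lemma fmlookup_Abs_fmap: "finite (dom m) \<Longrightarrow> fmlookup (Abs_fmap m) = m"
  by (simp add: Abs_fmap_inverse)

text \<open>Conditions supported by different countable sets are compared through enumerations
  \<open>e\<close> of these sets: \<open>push e\<close> copies a condition over the natural numbers
  to the columns in \<open>range e\<close>, and \<open>pull e\<close> restricts to these columns and
  reads the result in coordinates.\<close>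

definition push :: "(nat \<Rightarrow> 'c) \<Rightarrow> nat cond \<Rightarrow> 'c cond" where
  "push e s = Abs_fmap (\<lambda>(x, n). if x \<in> range e then fmlookup s (inv e x, n) else None)"

definition pull :: "(nat \<Rightarrow> 'c) \<Rightarrow> 'c cond \<Rightarrow> nat cond" where
  "pull e r = Abs_fmap (\<lambda>(i, n). fmlookup r (e i, n))"

lemma fmlookup_push:
  "fmlookup (push e s) (x, n) = (if x \<in> range e then fmlookup s (inv e x, n) else None)"
proof -
  let ?m = "\<lambda>(x, n). if x \<in> range e then fmlookup s (inv e x, n) else None"
  have "dom ?m \<subseteq> (\<lambda>(i, n). (e i, n)) ` fmdom' s"
  proof
    fix z assume "z \<in> dom ?m"
    then obtain x n y where "z = (x, n)" "x \<in> range e" "fmlookup s (inv e x, n) = Some y"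
      by (cases z) (auto split: if_splits)
    thus "z \<in> (\<lambda>(i, n). (e i, n)) ` fmdom' s"
      by (intro image_eqI[of _ _ "(inv e x, n)"]) (auto simp: f_inv_into_f intro: fmdom'I)
  qed
  hence "finite (dom ?m)" by (rule finite_subset) simp
  thus ?thesis by (simp add: push_def fmlookup_Abs_fmap)
qed

lemma fmlookup_push_at: "inj e \<Longrightarrow> fmlookup (push e s) (e i, n) = fmlookup s (i, n)"
  by (simp add: fmlookup_push)

lemma fmlookup_push_Some:
  assumes "inj e"
  shows "fmlookup (push e s) (x, n) = Some y \<longleftrightarrow> (\<exists>i. x = e i \<and> fmlookup s (i, n) = Some y)"
  using assms by (auto simp: fmlookup_push)

text \<open>Injectivity keeps the domain finite, as the preimage of a finite set.\<close>

lemma fmlookup_pull: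
  assumes "inj e"
  shows "fmlookup (pull e r) (i, n) = fmlookup r (e i, n)"
proof -
  let ?m = "\<lambda>(i, n). fmlookup r (e i, n)"
  have "dom ?m = (\<lambda>(i, n). (e i, n)) -` fmdom' r"
    by (auto simp: fmlookup_dom'_iff)
  moreover have "inj (\<lambda>(i, n :: nat). (e i, n))"
    using assms by (auto simp: inj_def)
  ultimately have "finite (dom ?m)" by (simp add: finite_vimageI)
  thus ?thesis by (simp add: pull_def fmlookup_Abs_fmap)
qed

lemma push_pull:
  assumes "inj e" "fst ` fmdom' t \<subseteq> range e"
  shows "push e (pull e t) = t"
proof (rule fmap_ext, clarify)
  fix x n
  have "fmlookup t (x, n) = None" if "x \<notin> range e"
    using assms(2) that by (metis fmdom'_notD fst_conv image_subset_iff)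
  thus "fmlookup (push e (pull e t)) (x, n) = fmlookup t (x, n)"
    using assms(1) by (auto simp: fmlookup_push fmlookup_pull)
qed

lemma push_stronger:
  assumes "inj e" "s \<preceq> t"
  shows "push e s \<preceq> push e t"
  using assms by (auto simp: stronger_iff fmlookup_push)

text \<open>An adjunction: a transported condition speaks only about the columns in
  \<open>range e\<close>, and \<open>pull e r\<close> is the part of \<open>r\<close> there.\<close>

lemma push_stronger_iff:
  assumes "inj e"
  shows "r \<preceq> push e s \<longleftrightarrow> pull e r \<preceq> s"
  using assms by (auto simp: stronger_iff fmlookup_push_Some fmlookup_pull)

text \<open>Inside \<open>range e\<close> the transported condition extends \<open>r\<close>, and
  elsewhere it is silent. So a strengthening found in coordinates can always be added to
  \<open>r\<close>.\<close>

lemma push_compat: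
  assumes "inj e" "s \<preceq> pull e r"
  shows "compat r (push e s)"
  using assms by (auto simp: compat_def stronger_iff fmlookup_push_Some fmlookup_pull)

section \<open>Countable supports\<close>

lemma countable_supported:
  assumes "countable A"
  shows "countable {s :: 'c cond. fst ` fmdom' s \<subseteq> A}"
proof (rule countable_subset)
  show "{s :: 'c cond. fst ` fmdom' s \<subseteq> A} \<subseteq> fmap_of_list ` lists ((A \<times> UNIV) \<times> UNIV)"
  proof clarify
    fix s :: "'c cond" assume s: "fst ` fmdom' s \<subseteq> A"
    obtain xs where xs: "fmap_of_list xs = s" using exists_fmap_of_list by blast
    have "fmdom' s = fst ` set xs"
      unfolding xs[symmetric] by (simp add: fmdom'_alt_def fset_of_list.rep_eq)
    hence "xs \<in> lists ((A \<times> UNIV) \<times> UNIV)" using s by force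
    thus "s \<in> fmap_of_list ` lists ((A \<times> UNIV) \<times> UNIV)" using xs by blast
  qed
  show "countable (fmap_of_list ` lists ((A \<times> UNIV) \<times> UNIV) :: 'c cond set)"
    using assms by (intro countable_image countable_lists countable_SIGMA) auto
qed

text \<open>A condition has finite domain, so if it is supported by the union of an increasing
  \<omega>-chain, it is supported by a member of the chain. Therefore \<omega> steps of closing off
  suffice.\<close>

lemma countable_closure:
  fixes F :: "'c cond \<Rightarrow> 'c set"
  assumes F: "\<And>s. countable (F s)" and u: "countable u0"
  shows "\<exists>u. countable u \<and> u0 \<subseteq> u \<and> (\<forall>s. fst ` fmdom' s \<subseteq> u \<longrightarrow> F s \<subseteq> u)"
proof -
  define U where "U = rec_nat u0 (\<lambda>_ A. A \<union> (\<Union>s\<in>{s. fst ` fmdom' s \<subseteq> A}. F s))"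
  have U0: "U 0 = u0" and US: "U (Suc n) = U n \<union> (\<Union>s\<in>{s. fst ` fmdom' s \<subseteq> U n}. F s)" for n
    by (auto simp: U_def)
  have "countable (U n)" for n
    by (induction n) (auto simp: U0 US u F intro!: countable_UN countable_supported)
  hence "countable (\<Union>n. U n)" by blast
  moreover have "u0 \<subseteq> (\<Union>n. U n)" using U0 by blast
  moreover have "F s \<subseteq> (\<Union>n. U n)" if s: "fst ` fmdom' s \<subseteq> (\<Union>n. U n)" for s
  proof -
    have mono: "U m \<subseteq> U n" if "m \<le> n" for m n
      using lift_Suc_mono_le[of U, OF _ that] by (simp add: US)
    have "\<exists>n. A \<subseteq> U n" if "finite A" "A \<subseteq> (\<Union>n. U n)" for A
      using that
    proof (induction A)
      case (insert a A)
      then obtain n m where "A \<subseteq> U n" "a \<in> U m" by auto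
      hence "insert a A \<subseteq> U (max n m)"
        using mono[of n "max n m"] mono[of m "max n m"] by auto
      thus ?case by blast
    qed auto
    then obtain n where "fst ` fmdom' s \<subseteq> U n" using s by (meson finite_fmdom' finite_imageI)
    hence "F s \<subseteq> U (Suc n)" by (auto simp: US)
    thus ?thesis by blast
  qed
  ultimately show ?thesis by blast
qed

text \<open>Read \<open>W j k v s\<close> as: \<open>s\<close> forces the value \<open>v\<close> at
  \<open>(j,k)\<close>. The range of \<open>e\<close> is closed under a choice of deciding
  conditions, so it is a countable support for these values. The index \<open>\<alpha>\<close>
  always gets coordinate 0, which makes different enumerations comparable.\<close>

lemma closed_enumeration:
  fixes \<alpha> :: 'c and W :: "nat \<Rightarrow> nat \<Rightarrow> int \<Rightarrow> 'c cond \<Rightarrow> bool"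
  assumes inf: "infinite (UNIV :: 'c set)"
    and total: "\<And>r j k. r \<preceq> q \<Longrightarrow> fmlookup r (\<alpha>, j) = Some k \<Longrightarrow> \<exists>s v. s \<preceq> r \<and> W j k v s"
  shows "\<exists>e :: nat \<Rightarrow> 'c. inj e \<and> e 0 = \<alpha> \<and> fst ` fmdom' q \<subseteq> range e \<and>
    (\<forall>s j k. push e s \<preceq> q \<longrightarrow> fmlookup s (0, j) = Some k \<longrightarrow>
      (\<exists>s' v. s' \<preceq> s \<and> W j k v (push e s')))"
proof -
  define S where "S r j k = (SOME s. s \<preceq> r \<and> (\<exists>v. W j k v s))" for r j k
  have S: "S r j k \<preceq> r \<and> (\<exists>v. W j k v (S r j k))" if "r \<preceq> q" "fmlookup r (\<alpha>, j) = Some k" for r j k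
    unfolding S_def by (rule someI_ex) (use total[OF that] in blast)
  obtain h :: "nat \<Rightarrow> 'c" where h: "inj h"
    using inf infinite_countable_subset by blast
  have dom: "countable (fst ` fmdom' t)" for t :: "'c cond"
    by (simp add: countable_finite)
  \<comment> \<open>The set to be closed off contains \<open>range h\<close>, hence it is infinite
    and can be enumerated injectively by all natural numbers.\<close>
  have F: "countable (\<Union>j k. fst ` fmdom' (S s j k))" for s
    using dom by (intro countable_UN) simp_all
  have u0: "countable ({\<alpha>} \<union> fst ` fmdom' q \<union> range h)"
    using dom by simp
  obtain u where u: "countable u" "{\<alpha>} \<union> fst ` fmdom' q \<union> range h \<subseteq> u"
      "\<And>s. fst ` fmdom' s \<subseteq> u \<Longrightarrow> (\<Union>j k. fst ` fmdom' (S s j k)) \<subseteq> u"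
    using countable_closure[of "\<lambda>s. \<Union>j k. fst ` fmdom' (S s j k)", OF F u0] by blast
  have "infinite u" using u(2) h by (meson finite_subset le_sup_iff range_inj_infinite)
  hence b: "bij_betw (from_nat_into (u - {\<alpha>})) UNIV (u - {\<alpha>})"
    using u(1) by (intro bij_betw_from_nat_into) auto
  define e where "e = case_nat \<alpha> (from_nat_into (u - {\<alpha>}))"
  have range: "range e = u"
  proof -
    have "range e = insert (e 0) (range (\<lambda>n. e (Suc n)))"
    proof (intro equalityI subsetI)
      fix x assume "x \<in> range e"
      then obtain m where "x = e m" by blast
      thus "x \<in> insert (e 0) (range (\<lambda>n. e (Suc n)))" by (cases m) auto
    qed auto
    also have "\<dots> = insert \<alpha> (range (from_nat_into (u - {\<alpha>})))" by (simp add: e_def)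
    also have "\<dots> = u" using b u(2) by (auto simp: bij_betw_def)
    finally show ?thesis .
  qed
  have "from_nat_into (u - {\<alpha>}) n \<noteq> \<alpha>" for n using b by (auto simp: bij_betw_def)
  hence inj: "inj e"
    using b by (auto simp: inj_def e_def bij_betw_def split: nat.splits)
  moreover have "e 0 = \<alpha>" by (simp add: e_def)
  moreover have "fst ` fmdom' q \<subseteq> range e" using u(2) range by simp
  moreover have "\<exists>s' v. s' \<preceq> s \<and> W j k v (push e s')"
    if s: "push e s \<preceq> q" "fmlookup s (0, j) = Some k" for s j k
  proof -
    define t where "t = S (push e s) j k"
    have "fmlookup (push e s) (\<alpha>, j) = Some k"
      using s(2) inj by (auto simp: fmlookup_push_Some e_def intro!: exI[of _ 0])
    hence t: "t \<preceq> push e s" "\<exists>v. W j k v t" using S s(1) by (auto simp: t_def)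
    have "fst ` fmdom' (push e s) \<subseteq> range e"
      using inj by (auto simp: fmlookup_dom'_iff fmlookup_push_Some)
    hence "fst ` fmdom' t \<subseteq> range e" using u(3)[of "push e s"] unfolding range t_def by blast
    hence "push e (pull e t) = t" using inj by (rule push_pull[rotated])
    moreover have "pull e t \<preceq> s" using t(1) inj by (simp add: push_stronger_iff)
    ultimately show ?thesis using t(2) by metis
  qed
  ultimately show ?thesis by blast
qed

section \<open>A uniform root for more than continuum many sequences\<close>

text \<open>Partial sequences of length \<omega> in \<open>M\<close>; in the search for a root,
  \<open>None\<close> marks the positions outside it.\<close>

definition seqs :: "'c set \<Rightarrow> (nat \<Rightarrow> 'c option) set" where
  "seqs M = {\<rho>. \<forall>i x. \<rho> i = Some x \<longrightarrow> x \<in> M}"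

lemma infinite_nat_sets: "infinite (UNIV :: nat set set)"
  by (simp add: Finite_Set.finite_set)

lemma card_of_countable_powerset:
  "|UNIV :: ('x :: countable) set set| \<le>o beth_1"
  by (rule card_of_ordLeqI[of "image to_nat"]) (auto simp: inj_image_eq_iff inj_on_def)

text \<open>The continuum to the power \<omega> is the continuum. With elements of \<open>M\<close>
  coded by sets of numbers, \<open>(i, None)\<close> records that position \<open>i\<close> is
  defined and \<open>(i, Some n)\<close> that \<open>n\<close> belongs to the code of its
  entry.\<close>

lemma card_of_seqs:
  assumes "|M| \<le>o beth_1"
  shows "|seqs M| \<le>o beth_1"
proof -
  obtain f :: "'a \<Rightarrow> nat set" where f: "inj_on f M"
    using assms by (auto simp: card_of_ordLeq[symmetric])
  define g where "g \<rho> = {(i :: nat, o'). \<exists>x. \<rho> i = Some x \<and> (case o' of None \<Rightarrow> True | Some n \<Rightarrow> n \<in> f x)}" for \<rho>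
  have g: "(i, None) \<in> g \<rho> \<longleftrightarrow> \<rho> i \<noteq> None" "\<rho> i = Some x \<Longrightarrow> (i, Some n) \<in> g \<rho> \<longleftrightarrow> n \<in> f x" for \<rho> i x n
    by (auto simp: g_def)
  have "inj_on g (seqs M)"
  proof (intro inj_onI ext)
    fix \<rho> \<sigma> i assume *: "\<rho> \<in> seqs M" "\<sigma> \<in> seqs M" "g \<rho> = g \<sigma>"
    show "\<rho> i = \<sigma> i"
    proof (cases "\<rho> i")
      case None
      thus ?thesis using g(1)[of i \<rho>] g(1)[of i \<sigma>] * by auto
    next
      case (Some x)
      then obtain y where y: "\<sigma> i = Some y" using g(1)[of i \<rho>] g(1)[of i \<sigma>] * by auto
      have "f x = f y" using g(2)[of \<rho> i x] g(2)[of \<sigma> i y] Some y * by blast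
      moreover have "x \<in> M" "y \<in> M" using * Some y by (auto simp: seqs_def)
      ultimately show ?thesis using f Some y by (auto dest: inj_onD)
    qed
  qed
  hence "|seqs M| \<le>o |UNIV :: (nat \<times> nat option) set set|"
    by (intro card_of_ordLeqI[of g]) auto
  thus ?thesis using card_of_countable_powerset ordLeq_transitive by blast
qed

text \<open>A transfinite closing-off along \<open>r\<close>, written as a positive inductive
  definition; unfolding it once gives the recursion equation \<open>G_eq\<close> below.\<close>

inductive stage :: "'i rel \<Rightarrow> ((nat \<Rightarrow> 'c option) \<Rightarrow> 'd \<Rightarrow> 'c set) \<Rightarrow> 'i \<Rightarrow> 'c \<Rightarrow> bool" for r U where
  "(\<And>i y. \<rho> i = Some y \<Longrightarrow> \<exists>z\<in>underS r x. stage r U z y) \<Longrightarrow> c \<in> U \<rho> t \<Longrightarrow> stage r U x c"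

text \<open>Closing off \<omega>_1 times suffices, since a countable sequence from the union appears
  at some stage. By \<open>card_of_seqs\<close> no stage exceeds the continuum.\<close>

lemma closure_under_sequences:
  fixes U :: "(nat \<Rightarrow> 'c option) \<Rightarrow> 'd \<Rightarrow> 'c set"
  assumes U: "\<And>\<rho> t. countable (U \<rho> t)" and D: "|UNIV :: 'd set| \<le>o beth_1"
  shows "\<exists>M. |M| \<le>o beth_1 \<and> (\<forall>\<rho> t. \<rho> \<in> seqs M \<longrightarrow> U \<rho> t \<subseteq> M)"
proof -
  let ?r = "cardSuc natLeq"
  define G where "G x = {c. stage ?r U x c}" for x
  have card: "Card_order ?r" by (simp add: cardSuc_Card_order natLeq_Card_order)
  hence wo: "Well_order ?r" by (rule card_order_on_well_order_on)
  have inf: "infinite (Field ?r)"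
    using cardSuc_finite[OF natLeq_Card_order] by (simp add: Field_natLeq)
  have nat_less: "natLeq <o beth_1"
    using card_of_Pow[of "UNIV :: nat set"] card_of_nat
    by (metis Pow_UNIV ordIso_ordLess_trans ordIso_symmetric)
  have r_le: "|Field ?r| \<le>o beth_1"
    by (meson card cardSuc_least card_of_Card_order card_of_Field_ordIso nat_less natLeq_Card_order
        ordIso_ordLeq_trans)
  have G_eq: "G x = (\<Union>\<rho>\<in>seqs (\<Union>z\<in>underS ?r x. G z). \<Union>t. U \<rho> t)" for x
    by (auto simp: G_def seqs_def stage.simps[of _ _ x])
  have U': "|U \<rho> t| \<le>o beth_1" for \<rho> t
    using U[of \<rho> t] by (meson UNIV_I card_of_ordLeqI card_of_nat countableE nat_less
        ordIso_ordLess_trans ordLess_imp_ordLeq ordLeq_transitive)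
  have "x \<in> Field ?r \<longrightarrow> |G x| \<le>o beth_1" for x
  proof (induction x rule: wf_induct[OF wo_rel.WF[of ?r]])
    show "wo_rel ?r" using wo by (simp add: wo_rel_def)
  next
    fix x assume IH: "\<forall>y. (y, x) \<in> ?r - Id \<longrightarrow> y \<in> Field ?r \<longrightarrow> |G y| \<le>o beth_1"
    have "underS ?r x \<subseteq> Field ?r" by (auto simp: underS_def Field_def)
    hence "|underS ?r x| \<le>o beth_1" using card_of_mono1 ordLeq_transitive r_le by blast
    hence *: "|\<Union>z\<in>underS ?r x. G z| \<le>o beth_1"
      using IH by (intro card_of_UNION_ordLeq_infinite infinite_nat_sets)
        (auto simp: underS_def Field_def)
    have "|\<Union>t. U \<rho> t| \<le>o beth_1" for \<rho>
      using U' by (intro card_of_UNION_ordLeq_infinite infinite_nat_sets D) simp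
    hence "|G x| \<le>o beth_1"
      unfolding G_eq[of x]
      by (intro card_of_UNION_ordLeq_infinite[OF infinite_nat_sets card_of_seqs[OF *]]) simp
    thus "x \<in> Field ?r \<longrightarrow> |G x| \<le>o beth_1" ..
  qed
  hence M: "|\<Union>x\<in>Field ?r. G x| \<le>o beth_1"
    using r_le by (intro card_of_UNION_ordLeq_infinite infinite_nat_sets) auto
  have chain: "relChain ?r G"
    unfolding relChain_def
  proof (intro allI impI)
    fix i j assume ij: "(i, j) \<in> ?r"
    have "trans ?r" "antisym ?r"
      using wo unfolding order_on_defs by auto
    hence "underS ?r i \<subseteq> underS ?r j" using ij by (rule underS_incr)
    hence "seqs (\<Union>z\<in>underS ?r i. G z) \<subseteq> seqs (\<Union>z\<in>underS ?r j. G z)"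
      by (fastforce simp: seqs_def)
    thus "G i \<subseteq> G j" unfolding G_eq[of i] G_eq[of j] by (rule UN_mono) blast
  qed
  have "U \<rho> t \<subseteq> (\<Union>x\<in>Field ?r. G x)" if \<rho>: "\<rho> \<in> seqs (\<Union>x\<in>Field ?r. G x)" for \<rho> t
  proof -
    define B where "B = {y. \<exists>i. \<rho> i = Some y}"
    have "B \<subseteq> (\<lambda>i. the (\<rho> i)) ` UNIV" by (auto simp: B_def) (metis option.sel rangeI)
    hence B: "|B| \<le>o natLeq"
      by (meson card_of_image card_of_mono1 card_of_nat ordLeq_ordIso_trans ordLeq_transitive)
    have "infinite (Field natLeq)" by (simp add: Field_natLeq)
    moreover have "B \<subseteq> (\<Union>x\<in>Field ?r. G x)" using \<rho> by (auto simp: B_def seqs_def)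
    \<comment> \<open>Regularity of \<omega>_1 puts the countable range of \<open>\<rho>\<close>
      into one stage \<open>i\<close>. A later \<open>j\<close> is taken because
      \<open>stage\<close> admits entries from strictly earlier stages only.\<close>
    ultimately obtain i where i: "i \<in> Field ?r" "B \<subseteq> G i"
      using cardSuc_UNION[OF natLeq_Card_order _ chain _ B] by blast
    obtain j where j: "j \<in> Field ?r" "i \<noteq> j" "(i, j) \<in> ?r"
      using infinite_Card_order_limit[OF card inf i(1)] by blast
    have "\<rho> \<in> seqs (\<Union>z\<in>underS ?r j. G z)"
      using i(2) j by (auto simp: seqs_def B_def underS_def)
    hence "U \<rho> t \<subseteq> G j" unfolding G_eq[of j] by blast
    thus ?thesis using j(1) by blast
  qed
  with M show ?thesis by blast
qed

text \<open>
  A weak \<open>\<Delta>\<close>-system lemma: the root is read off from any member of the family that is not contained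
  in a set of size continuum closed under the counterexamples.
\<close>

lemma uniform_root:
  fixes e :: "'x \<Rightarrow> nat \<Rightarrow> 'c" and \<tau> :: "'x \<Rightarrow> 'd"
  assumes K: "beth_1 <o |K|" and D: "|UNIV :: 'd set| \<le>o beth_1"
    and inj: "inj_on (\<lambda>\<xi>. (e \<xi>, \<tau> \<xi>)) K"
  shows "\<exists>R \<rho> t. R \<noteq> UNIV \<and> (\<forall>u. countable u \<longrightarrow>
    (\<exists>\<xi>\<in>K. \<tau> \<xi> = t \<and> (\<forall>i\<in>R. e \<xi> i = \<rho> i) \<and> (\<forall>i. i \<notin> R \<longrightarrow> e \<xi> i \<notin> u)))"
proof -
  \<comment> \<open>A countable \<open>u\<close> refutes \<open>\<rho>\<close> as a root for the
    type \<open>t\<close>: every member of type \<open>t\<close> that follows \<open>\<rho>\<close>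
    meets \<open>u\<close> at a position where \<open>\<rho>\<close> is undefined.\<close>
  define bad where "bad \<rho> t u \<longleftrightarrow> countable u \<and>
    (\<forall>\<xi>\<in>K. \<tau> \<xi> = t \<longrightarrow> (\<forall>i x. \<rho> i = Some x \<longrightarrow> e \<xi> i = x) \<longrightarrow> (\<exists>i. \<rho> i = None \<and> e \<xi> i \<in> u))"
    for \<rho> t u
  define U where "U \<rho> t = (if \<exists>u. bad \<rho> t u then SOME u. bad \<rho> t u else {})" for \<rho> t
  have U: "bad \<rho> t (U \<rho> t)" if "bad \<rho> t u" for \<rho> t u
    using that by (auto simp: U_def intro: someI)
  have countable: "countable (U \<rho> t)" for \<rho> t
  proof (cases "\<exists>u. bad \<rho> t u")
    case True
    then obtain u where "bad \<rho> t u" by blast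
    from U[OF this] show ?thesis by (simp add: bad_def)
  qed (simp add: U_def)
  obtain M where M: "|M| \<le>o beth_1" "\<And>\<rho> t. \<rho> \<in> seqs M \<Longrightarrow> U \<rho> t \<subseteq> M"
    using closure_under_sequences[of U, OF countable D] by blast
  \<comment> \<open>Sequences in \<open>M\<close> paired with types are at most continuum many, so
    they cannot account for all of \<open>K\<close>.\<close>
  have "\<exists>\<xi>\<in>K. \<not> range (e \<xi>) \<subseteq> M"
  proof (rule ccontr)
    assume "\<not> (\<exists>\<xi>\<in>K. \<not> range (e \<xi>) \<subseteq> M)"
    hence "(\<lambda>\<xi>. (Some \<circ> e \<xi>, \<tau> \<xi>)) ` K \<subseteq> seqs M \<times> UNIV"
      by (auto simp: seqs_def image_subset_iff)
    moreover have "inj_on (\<lambda>\<xi>. (Some \<circ> e \<xi>, \<tau> \<xi>)) K"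
      using inj by (auto simp: inj_on_def fun_eq_iff)
    ultimately have "|K| \<le>o |seqs M \<times> (UNIV :: 'd set)|"
      by (intro card_of_ordLeqI) auto
    also have "|seqs M \<times> (UNIV :: 'd set)| \<le>o beth_1"
      by (rule card_of_Times_le[OF infinite_nat_sets card_of_seqs[OF M(1)] D])
    finally show False using K not_ordLess_ordLeq by blast
  qed
  then obtain \<xi> where \<xi>: "\<xi> \<in> K" "\<not> range (e \<xi>) \<subseteq> M" by blast
  \<comment> \<open>The root is the trace of \<open>e \<xi>\<close> on \<open>M\<close>. If it were
    refuted, then by a countable subset of \<open>M\<close>; but \<open>\<xi>\<close> itself avoids
    \<open>M\<close> at all positions outside the root.\<close>
  define \<rho> where "\<rho> i = (if e \<xi> i \<in> M then Some (e \<xi> i) else None)" for i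
  have good: "\<not> bad \<rho> (\<tau> \<xi>) u" for u
  proof
    assume "bad \<rho> (\<tau> \<xi>) u"
    hence "bad \<rho> (\<tau> \<xi>) (U \<rho> (\<tau> \<xi>))" by (rule U)
    moreover have "\<forall>i x. \<rho> i = Some x \<longrightarrow> e \<xi> i = x" by (auto simp: \<rho>_def)
    ultimately obtain i where "\<rho> i = None" "e \<xi> i \<in> U \<rho> (\<tau> \<xi>)"
      using \<xi>(1) unfolding bad_def by blast
    moreover have "\<rho> \<in> seqs M" by (auto simp: \<rho>_def seqs_def split: if_splits)
    ultimately show False using M(2) by (auto simp: \<rho>_def split: if_splits)
  qed
  show ?thesis
  proof (intro exI[of _ "{i. e \<xi> i \<in> M}"] exI[of _ "e \<xi>"] exI[of _ "\<tau> \<xi>"] conjI allI impI)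
    show "{i. e \<xi> i \<in> M} \<noteq> UNIV" using \<xi>(2) by auto
    fix u :: "'c set" assume "countable u"
    with good[of u] obtain \<eta> where "\<eta> \<in> K" "\<tau> \<eta> = \<tau> \<xi>" "\<forall>i x. \<rho> i = Some x \<longrightarrow> e \<eta> i = x"
      "\<not> (\<exists>i. \<rho> i = None \<and> e \<eta> i \<in> u)" unfolding bad_def by blast
    thus "\<exists>\<eta>\<in>K. \<tau> \<eta> = \<tau> \<xi> \<and> (\<forall>i\<in>{i. e \<xi> i \<in> M}. e \<eta> i = e \<xi> i) \<and>
        (\<forall>i. i \<notin> {i. e \<xi> i \<in> M} \<longrightarrow> e \<eta> i \<notin> u)"
      by (intro bexI[of _ \<eta>]) (auto simp: \<rho>_def split: if_splits)
  qed
qed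

lemma fmlookup_bounded:
  fixes r :: "'c cond"
  obtains N where "\<And>x m. N \<le> m \<Longrightarrow> fmlookup r (x, m) = None"
proof -
  have "finite (snd ` fmdom' r)" by simp
  then obtain N where N: "\<And>m. m \<in> snd ` fmdom' r \<Longrightarrow> m < N"
    by (auto simp: finite_nat_set_iff_bounded)
  have "fmlookup r (x, m) = None" if "N \<le> m" for x m
  proof (rule ccontr)
    assume "fmlookup r (x, m) \<noteq> None"
    hence "m \<in> snd ` fmdom' r" by (force simp: fmlookup_dom'_iff)
    with N that show False by force
  qed
  with that show thesis by blast
qed

text \<open>
  \<open>V \<xi> j k v r\<close> stands for \<open>r \<tturnstile> \<phi>\<^sub>\<xi>(j,k) = v\<close> and \<open>T j k v r\<close> for \<open>r \<tturnstile> \<psi>(j,k) = v\<close>. Of the points of \<open>I(f\<^sub>\<xi>)\<close>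
  only those on the graph of the Cohen real \<open>f\<^sub>\<xi>\<close> matter, since a generic extension of a condition can
  put any point of a fresh column there.
\<close>

lemma uniform_approximation:
  fixes q :: "'x \<Rightarrow> 'c cond" and \<alpha> :: "'x \<Rightarrow> 'c"
    and V :: "'x \<Rightarrow> nat \<Rightarrow> nat \<Rightarrow> int \<Rightarrow> 'c cond \<Rightarrow> bool"
  assumes inf: "infinite (UNIV :: 'c set)" and K: "beth_1 <o |K|"
    and le: "\<And>\<xi>. \<xi> \<in> K \<Longrightarrow> q \<xi> \<preceq> p0"
    and inj: "\<And>\<xi> \<eta> r. \<xi> \<in> K \<Longrightarrow> \<eta> \<in> K \<Longrightarrow> \<alpha> \<xi> = \<alpha> \<eta> \<Longrightarrow> r \<preceq> q \<xi> \<Longrightarrow> r \<preceq> q \<eta> \<Longrightarrow> \<xi> = \<eta>"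
    and mono: "\<And>\<xi> j k v r s. V \<xi> j k v r \<Longrightarrow> s \<preceq> r \<Longrightarrow> V \<xi> j k v s"
    and unique: "\<And>\<xi> j k v v' r. \<xi> \<in> K \<Longrightarrow> r \<preceq> q \<xi> \<Longrightarrow> V \<xi> j k v r \<Longrightarrow> V \<xi> j k v' r \<Longrightarrow> v = v'"
    and total: "\<And>\<xi> j k r. \<xi> \<in> K \<Longrightarrow> r \<preceq> q \<xi> \<Longrightarrow> fmlookup r (\<alpha> \<xi>, j) = Some k \<Longrightarrow>
      \<exists>s v. s \<preceq> r \<and> V \<xi> j k v s"
    and coherent: "\<And>\<xi> \<eta> r. \<xi> \<in> K \<Longrightarrow> \<eta> \<in> K \<Longrightarrow> r \<preceq> q \<xi> \<Longrightarrow> r \<preceq> q \<eta> \<Longrightarrow>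
      \<exists>r' n. r' \<preceq> r \<and> (\<forall>j k s v v'. n \<le> j \<longrightarrow> s \<preceq> r' \<longrightarrow> fmlookup s (\<alpha> \<xi>, j) = Some k \<longrightarrow>
        fmlookup s (\<alpha> \<eta>, j) = Some k \<longrightarrow> V \<xi> j k v s \<longrightarrow> V \<eta> j k v' s \<longrightarrow> v = v')"
  shows "\<exists>p (T :: nat \<Rightarrow> nat \<Rightarrow> int \<Rightarrow> 'c cond \<Rightarrow> bool). p \<preceq> p0 \<and>
    (\<forall>j k v r s. T j k v r \<longrightarrow> s \<preceq> r \<longrightarrow> T j k v s) \<and>
    (\<forall>j k v v' r. r \<preceq> p \<longrightarrow> T j k v r \<longrightarrow> T j k v' r \<longrightarrow> v = v') \<and>
    (\<forall>j k r. r \<preceq> p \<longrightarrow> (\<exists>s v. s \<preceq> r \<and> T j k v s)) \<and>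
    (\<forall>q' u. q' \<preceq> p \<longrightarrow> countable u \<longrightarrow> (\<exists>\<xi>\<in>K. \<exists>s n. s \<preceq> q' \<and> s \<preceq> q \<xi> \<and> \<alpha> \<xi> \<notin> u \<and>
      (\<forall>j k v v' r. n \<le> j \<longrightarrow> r \<preceq> s \<longrightarrow> fmlookup r (\<alpha> \<xi>, j) = Some k \<longrightarrow> V \<xi> j k v r \<longrightarrow>
        T j k v' r \<longrightarrow> v = v')))"
proof -

  \<comment> \<open>Isomorphism types and their common root\<close>
  have "\<exists>e. inj e \<and> e 0 = \<alpha> \<xi> \<and> fst ` fmdom' (q \<xi>) \<subseteq> range e \<and>
      (\<forall>s j k. push e s \<preceq> q \<xi> \<longrightarrow> fmlookup s (0, j) = Some k \<longrightarrow>
        (\<exists>s' v. s' \<preceq> s \<and> V \<xi> j k v (push e s')))" if "\<xi> \<in> K" for \<xi>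
    by (rule closed_enumeration[OF inf total[OF that]])
  then obtain e where e: "\<And>\<xi>. \<xi> \<in> K \<Longrightarrow> inj (e \<xi>)" "\<And>\<xi>. \<xi> \<in> K \<Longrightarrow> e \<xi> 0 = \<alpha> \<xi>"
      "\<And>\<xi>. \<xi> \<in> K \<Longrightarrow> fst ` fmdom' (q \<xi>) \<subseteq> range (e \<xi>)"
      "\<And>\<xi> s j k. \<xi> \<in> K \<Longrightarrow> push (e \<xi>) s \<preceq> q \<xi> \<Longrightarrow> fmlookup s (0, j) = Some k \<Longrightarrow>
        \<exists>s' v. s' \<preceq> s \<and> V \<xi> j k v (push (e \<xi>) s')"
    by metis
  \<comment> \<open>The isomorphism type: which relabelled conditions force which values, and the
    relabelled \<open>q \<xi>\<close>. There are countably many conditions over the natural numbers,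
    hence at most continuum many types.\<close>
  define \<tau> where "\<tau> \<xi> = ({(j, k, v, s). V \<xi> j k v (push (e \<xi>) s)}, pull (e \<xi>) (q \<xi>))" for \<xi>
  have q_push: "q \<xi> = push (e \<xi>) (pull (e \<xi>) (q \<xi>))" if "\<xi> \<in> K" for \<xi>
    using push_pull[OF e(1,3)[OF that]] by simp
  \<comment> \<open>Enumeration and type give back \<open>q \<xi>\<close> and
    \<open>\<alpha> \<xi>\<close>, which determine \<open>\<xi>\<close> by
    \<open>inj\<close>.\<close>
  have inj': "inj_on (\<lambda>\<xi>. (e \<xi>, \<tau> \<xi>)) K"
  proof (rule inj_onI)
    fix \<xi> \<eta> assume *: "\<xi> \<in> K" "\<eta> \<in> K" "(e \<xi>, \<tau> \<xi>) = (e \<eta>, \<tau> \<eta>)"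
    hence e_eq: "e \<xi> = e \<eta>" and pull_eq: "pull (e \<xi>) (q \<xi>) = pull (e \<eta>) (q \<eta>)"
      unfolding \<tau>_def prod.inject by blast+
    have "push (e \<xi>) (pull (e \<xi>) (q \<xi>)) = push (e \<eta>) (pull (e \<eta>) (q \<eta>))"
      by (simp only: pull_eq, simp only: e_eq)
    hence "q \<xi> = q \<eta>" using q_push *(1,2) by metis
    moreover have "\<alpha> \<xi> = \<alpha> \<eta>" using * e(2)[of \<xi>] e(2)[of \<eta>] by simp
    ultimately show "\<xi> = \<eta>" using inj[OF *(1,2)] by (metis stronger_refl)
  qed
  have card': "|UNIV \<times> UNIV :: ((nat \<times> nat \<times> int \<times> nat cond) set \<times> nat cond) set| \<le>o beth_1"
  proof (intro card_of_Times_le infinite_nat_sets card_of_countable_powerset)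
    have "|UNIV :: nat cond set| \<le>o |UNIV :: nat cond set set|"
      by (rule card_of_ordLeqI[of "\<lambda>x. {x}"]) auto
    thus "|UNIV :: nat cond set| \<le>o beth_1"
      using card_of_countable_powerset ordLeq_transitive by blast
  qed
  obtain R \<rho> t where R: "R \<noteq> UNIV" and root: "\<And>u. countable u \<Longrightarrow>
      \<exists>\<xi>\<in>K. \<tau> \<xi> = t \<and> (\<forall>i\<in>R. e \<xi> i = \<rho> i) \<and> (\<forall>i. i \<notin> R \<longrightarrow> e \<xi> i \<notin> u)"
    using uniform_root[OF K card'[unfolded UNIV_Times_UNIV] inj'] by blast
  obtain V' c where t: "t = (V', c)" by (cases t)
  have type: "V \<xi> j k v (push (e \<xi>) s) \<longleftrightarrow> (j, k, v, s) \<in> V'" "q \<xi> = push (e \<xi>) c"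
    if "\<xi> \<in> K" "\<tau> \<xi> = t" for \<xi> j k v s
    using that q_push[of \<xi>] by (auto simp: \<tau>_def t)

  \<comment> \<open>Amalgamation of two members of the same type\<close>
  obtain \<xi> where \<xi>: "\<xi> \<in> K" "\<tau> \<xi> = t" "\<And>i. i \<in> R \<Longrightarrow> e \<xi> i = \<rho> i"
    using root[of "{}"] by auto
  obtain \<eta> where \<eta>: "\<eta> \<in> K" "\<tau> \<eta> = t" "\<And>i. i \<in> R \<Longrightarrow> e \<eta> i = \<rho> i" "\<And>i. i \<notin> R \<Longrightarrow> e \<eta> i \<notin> range (e \<xi>)"
    using root[of "range (e \<xi>)"] by auto
  \<comment> \<open>The two supports share only root columns, with equal coordinates. Hence copies
    along \<open>e \<xi>\<close> and \<open>e \<eta>\<close> are compatible once they agree on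
    \<open>R\<close>.\<close>
  have cross: "i' \<in> R \<and> i = i'" if "e \<xi> i = e \<eta> i'" for i i'
    using that \<xi>(3) \<eta>(3,4) e(1)[OF \<xi>(1)] by (metis injD rangeI)
  have total': "\<exists>s' v. s' \<preceq> s \<and> (j, k, v, s') \<in> V'" if "s \<preceq> c" "fmlookup s (0, j) = Some k" for s j k
    using e(4)[OF \<xi>(1) _ that(2)] type[OF \<xi>(1,2)] push_stronger[OF e(1)[OF \<xi>(1)] that(1)] by simp
  define r0 where "r0 = q \<xi> ++\<^sub>f q \<eta>"
  have "compat (q \<xi>) (q \<eta>)"
    unfolding compat_def type(2)[OF \<xi>(1,2)] type(2)[OF \<eta>(1,2)]
      fmlookup_push_Some[OF e(1)[OF \<xi>(1)]] fmlookup_push_Some[OF e(1)[OF \<eta>(1)]]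
    using cross by (metis option.inject)
  hence r0: "r0 \<preceq> q \<xi>" "r0 \<preceq> q \<eta>"
    by (auto simp: r0_def fmadd_stronger1 fmadd_stronger2)
  \<comment> \<open>If the Cohen index were in the root, \<open>inj\<close> would give
    \<open>\<xi> = \<eta>\<close>, although \<open>e \<eta>\<close> leaves
    \<open>range (e \<xi>)\<close> outside \<open>R\<close>.\<close>
  have "0 \<notin> R"
  proof
    assume "0 \<in> R"
    hence "\<alpha> \<xi> = \<alpha> \<eta>" using e(2) \<xi> \<eta> by metis
    hence "\<xi> = \<eta>" using inj[OF \<xi>(1) \<eta>(1) _ r0] by simp
    with R \<eta>(4) show False by blast
  qed
  obtain r' n where r': "r' \<preceq> r0" and coh: "\<And>j k s v v'. n \<le> j \<Longrightarrow> s \<preceq> r' \<Longrightarrow>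
      fmlookup s (\<alpha> \<xi>, j) = Some k \<Longrightarrow> fmlookup s (\<alpha> \<eta>, j) = Some k \<Longrightarrow> V \<xi> j k v s \<Longrightarrow> V \<eta> j k v' s \<Longrightarrow> v = v'"
    using coherent[OF \<xi>(1) \<eta>(1) r0] by blast
  \<comment> \<open>The parts of \<open>r'\<close> on the two supports, in common coordinates. Both
    extend \<open>c\<close>, and they coincide on \<open>R\<close>.\<close>
  define a b where "a = pull (e \<xi>) r'" and "b = pull (e \<eta>) r'"
  have r'_le: "r' \<preceq> q \<xi>" "r' \<preceq> q \<eta>" using r' r0 stronger_trans by blast+
  have ac: "a \<preceq> c" and bc: "b \<preceq> c"
    using r'_le type(2)[OF \<xi>(1,2)] type(2)[OF \<eta>(1,2)] e(1)[OF \<xi>(1)] e(1)[OF \<eta>(1)]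
    by (simp_all add: a_def b_def push_stronger_iff)
  have a_lookup: "fmlookup a (i, m) = fmlookup r' (e \<xi> i, m)" for i m
    using e(1)[OF \<xi>(1)] by (simp add: a_def fmlookup_pull)
  have b_lookup: "fmlookup b (i, m) = fmlookup r' (e \<eta> i, m)" for i m
    using e(1)[OF \<eta>(1)] by (simp add: b_def fmlookup_pull)
  obtain N where N: "\<And>x m. N \<le> m \<Longrightarrow> fmlookup r' (x, m) = None" by (rule fmlookup_bounded) blast
  \<comment> \<open>Beyond \<open>n\<close> coherence applies; beyond \<open>N\<close> the condition
    \<open>r'\<close> is silent, so values of the Cohen reals are still free there.\<close>
  define n1 where "n1 = max n N"

  \<comment> \<open>With \<open>s\<close> placed on the support of \<open>\<xi>\<close> and
    \<open>s'\<close> on that of \<open>\<eta>\<close>, both can be added to \<open>r'\<close>. The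
    result puts \<open>(j,k)\<close> on both Cohen graphs and decides both values, so coherence
    applies.\<close>
  have agree: "v = v'"
    if s: "s \<preceq> a" "s' \<preceq> b" "fmlookup s (0, j) = Some k" "fmlookup s' (0, j) = Some k" "n1 \<le> j"
      "(j, k, v, s) \<in> V'" "(j, k, v', s') \<in> V'"
      and root_compat: "\<And>i m y z. i \<in> R \<Longrightarrow> fmlookup s (i, m) = Some y \<Longrightarrow> fmlookup s' (i, m) = Some z \<Longrightarrow> y = z"
    for s s' j k v v'
  proof -
    define r1 where "r1 = r' ++\<^sub>f push (e \<xi>) s"
    define r2 where "r2 = r1 ++\<^sub>f push (e \<eta>) s'"
    have c1: "compat r' (push (e \<xi>) s)" and c2: "compat r' (push (e \<eta>) s')"
      using s(1,2) e(1)[OF \<xi>(1)] e(1)[OF \<eta>(1)] by (simp_all add: push_compat a_def b_def)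
    have "compat (push (e \<xi>) s) (push (e \<eta>) s')"
      unfolding compat_def fmlookup_push_Some[OF e(1)[OF \<xi>(1)]] fmlookup_push_Some[OF e(1)[OF \<eta>(1)]]
      using cross root_compat by metis
    hence "compat r1 (push (e \<eta>) s')"
      using c2 unfolding compat_def r1_def by (auto split: if_splits)
    hence r2: "r2 \<preceq> r1" "r2 \<preceq> push (e \<eta>) s'"
      by (simp_all add: r2_def fmadd_stronger1 fmadd_stronger2)
    have r1: "r1 \<preceq> r'" "r1 \<preceq> push (e \<xi>) s"
      using c1 by (simp_all add: r1_def fmadd_stronger1 fmadd_stronger2)
    have le: "r2 \<preceq> r'" "r2 \<preceq> push (e \<xi>) s" using r2 r1 stronger_trans by blast+
    have "fmlookup r2 (\<alpha> \<xi>, j) = Some k"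
      using s(3) fmlookup_push_at[OF e(1)[OF \<xi>(1)], of _ 0 j] e(2)[OF \<xi>(1)]
      by (intro strongerD[OF le(2)]) simp
    moreover have "fmlookup r2 (\<alpha> \<eta>, j) = Some k"
      using s(4) fmlookup_push_at[OF e(1)[OF \<eta>(1)], of _ 0 j] e(2)[OF \<eta>(1)]
      by (intro strongerD[OF r2(2)]) simp
    moreover have "V \<xi> j k v r2" using s(6) type(1)[OF \<xi>(1,2)] le(2) mono by blast
    moreover have "V \<eta> j k v' r2" using s(7) type(1)[OF \<eta>(1,2)] r2(2) mono by blast
    moreover have "n \<le> j" using s(5) by (simp add: n1_def)
    ultimately show ?thesis using coh[OF _ le(1)] by blast
  qed

  \<comment> \<open>The function determined by the root\<close>
  define p where "p = fmfilter (\<lambda>(x, m). x \<in> \<rho> ` R) r'"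
  have p_lookup: "fmlookup r (\<rho> i, m) = Some y" if "r \<preceq> p" "i \<in> R" "fmlookup r' (\<rho> i, m) = Some y" for r i m y
    using that by (intro strongerD[OF that(1)]) (auto simp: p_def)
  \<comment> \<open>Before the value is decided, \<open>d\<close> absorbs what \<open>r\<close> says
    on the root columns and the value \<open>k\<close> of the Cohen real at \<open>j\<close>; the
    latter is free as \<open>0 \<notin> R\<close> and \<open>j\<close> is beyond \<open>N\<close>.
    Both \<open>a\<close> and \<open>b\<close> will serve as \<open>d\<close>.\<close>
  have extend: "\<exists>s v. s \<preceq> d \<and> fmlookup s (0, j) = Some k \<and> (j, k, v, s) \<in> V' \<and>
      (\<forall>i m y. i \<in> R \<longrightarrow> fmlookup r (\<rho> i, m) = Some y \<longrightarrow> fmlookup s (i, m) = Some y)"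
    if d: "d \<preceq> c" "\<And>i m. i \<in> R \<Longrightarrow> fmlookup d (i, m) = fmlookup r' (\<rho> i, m)"
      "\<And>i m. N \<le> m \<Longrightarrow> fmlookup d (i, m) = None" and r: "r \<preceq> p" and j: "n1 \<le> j" for d r j k
  proof -
    define f where "f = fmfilter (\<lambda>(i, m). i \<in> R) (pull (e \<xi>) r)"
    have f: "fmlookup f (i, m) = (if i \<in> R then fmlookup r (\<rho> i, m) else None)" for i m
      using e(1)[OF \<xi>(1)] \<xi>(3) by (simp add: f_def fmlookup_pull)
    define d' where "d' = fmupd (0, j) k (d ++\<^sub>f f)"
    have "compat d f"
      using d(2) p_lookup[OF r] by (auto simp: compat_def f split: if_splits)
    hence d1: "d ++\<^sub>f f \<preceq> d" by (rule fmadd_stronger1)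
    have "fmlookup (d ++\<^sub>f f) (0, j) = None"
      using \<open>0 \<notin> R\<close> d(3)[of j 0] j by (auto simp: f fmlookup_dom_iff n1_def)
    hence d2: "d' \<preceq> d ++\<^sub>f f" unfolding d'_def by (rule stronger_fmupd)
    have "d' \<preceq> c" using d(1) d1 d2 stronger_trans by blast
    moreover have "fmlookup d' (0, j) = Some k" by (simp add: d'_def)
    ultimately obtain s v where s: "s \<preceq> d'" "(j, k, v, s) \<in> V'"
      using total' by blast
    have "s \<preceq> d" "s \<preceq> f"
      using s(1) d1 d2 fmadd_stronger2[of d f] stronger_trans by blast+
    moreover have "fmlookup s (0, j) = Some k" by (rule strongerD[OF s(1)]) (simp add: d'_def)
    ultimately show ?thesis using s(2) f by (metis strongerD)
  qed
  have a_ok: "a \<preceq> c" "\<And>i m. i \<in> R \<Longrightarrow> fmlookup a (i, m) = fmlookup r' (\<rho> i, m)"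
      "\<And>i m. N \<le> m \<Longrightarrow> fmlookup a (i, m) = None"
    using ac N \<xi>(3) by (auto simp: a_lookup)
  have b_ok: "b \<preceq> c" "\<And>i m. i \<in> R \<Longrightarrow> fmlookup b (i, m) = fmlookup r' (\<rho> i, m)"
      "\<And>i m. N \<le> m \<Longrightarrow> fmlookup b (i, m) = None"
    using bc N \<eta>(3) by (auto simp: b_lookup)

  \<comment> \<open>The value at \<open>(j,k)\<close> is \<open>v\<close> as soon as
    \<open>r\<close> contains the root part of some condition below \<open>a\<close> that puts
    \<open>(j,k)\<close> on the Cohen graph and decides the value \<open>v\<close>. Rows before
    \<open>n1\<close> get the default value 0.\<close>
  define T where "T j k v r \<longleftrightarrow> (if n1 \<le> j then \<exists>s. s \<preceq> a \<and> fmlookup s (0, j) = Some k \<and> (j, k, v, s) \<in> V' \<and>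
      (\<forall>i m y. i \<in> R \<longrightarrow> fmlookup s (i, m) = Some y \<longrightarrow> fmlookup r (\<rho> i, m) = Some y) else v = 0)"
    for j k v r
  show ?thesis
  proof (rule exI[of _ p], rule exI[of _ T], intro conjI allI impI)
    \<comment> \<open>The support of this member meets that of \<open>p0\<close> in root columns
      only. As \<open>q \<zeta>\<close> extends \<open>p0\<close>, all of \<open>p0\<close> lives on
      root columns, where \<open>p\<close> copies \<open>r'\<close>.\<close>
    obtain \<zeta> where \<zeta>: "\<zeta> \<in> K" "\<tau> \<zeta> = t" "\<And>i. i \<in> R \<Longrightarrow> e \<zeta> i = \<rho> i"
        "\<And>i. i \<notin> R \<Longrightarrow> e \<zeta> i \<notin> fst ` fmdom' p0"
      using root[of "fst ` fmdom' p0"] by (auto simp: countable_finite)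
    show "p \<preceq> p0"
      unfolding stronger_iff
    proof (intro allI impI)
      fix x m y assume p0: "fmlookup p0 (x, m) = Some y"
      hence "fmlookup (push (e \<zeta>) c) (x, m) = Some y"
        using le[OF \<zeta>(1)] type(2)[OF \<zeta>(1,2)] by (metis strongerD)
      then obtain i where i: "x = e \<zeta> i" "fmlookup c (i, m) = Some y"
        using e(1)[OF \<zeta>(1)] by (auto simp: fmlookup_push_Some)
      have "x \<in> fst ` fmdom' p0" using p0 by (force simp: fmlookup_dom'_iff)
      hence "i \<in> R" using i(1) \<zeta>(4)[of i] by metis
      moreover have "fmlookup r' (e \<xi> i, m) = Some y"
        using strongerD[OF ac i(2)] by (simp add: a_lookup)
      ultimately show "fmlookup p (x, m) = Some y"
        using i(1) \<xi>(3) \<zeta>(3) by (simp add: p_def)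
    qed
  next
    fix j k v r s assume "T j k v r" "s \<preceq> r"
    thus "T j k v s" unfolding T_def by (meson strongerD)
  next
    fix j k v v' r assume r: "r \<preceq> p" and T: "T j k v r" "T j k v' r"
    show "v = v'"
    proof (cases "n1 \<le> j")
      case j: True
      \<comment> \<open>Since \<open>agree\<close> compares the side of \<open>a\<close> with the
        side of \<open>b\<close>, two values read on the side of \<open>a\<close> are both compared
        with a value \<open>w\<close> from the side of \<open>b\<close>.\<close>
      from extend[OF b_ok r j, of k] obtain s' w where s': "s' \<preceq> b" "fmlookup s' (0, j) = Some k"
        "(j, k, w, s') \<in> V'" "\<And>i m y. i \<in> R \<Longrightarrow> fmlookup r (\<rho> i, m) = Some y \<Longrightarrow> fmlookup s' (i, m) = Some y"
        by blast
      have "v = w" if T: "T j k v r" for v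
      proof -
        obtain s where s: "s \<preceq> a" "fmlookup s (0, j) = Some k" "(j, k, v, s) \<in> V'"
          "\<And>i m y. i \<in> R \<Longrightarrow> fmlookup s (i, m) = Some y \<Longrightarrow> fmlookup r (\<rho> i, m) = Some y"
          using T j unfolding T_def by auto
        show ?thesis
        proof (rule agree[OF s(1) s'(1) s(2) s'(2) j s(3) s'(3)])
          fix i m y z assume "i \<in> R" "fmlookup s (i, m) = Some y" "fmlookup s' (i, m) = Some z"
          with s(4) s'(4) show "y = z" by fastforce
        qed
      qed
      with T show ?thesis by metis
    qed (use T in \<open>simp add: T_def\<close>)
  next
    fix j k r assume r: "r \<preceq> p"
    show "\<exists>s v. s \<preceq> r \<and> T j k v s"
    proof (cases "n1 \<le> j")
      case j: True
      from extend[OF a_ok r j, of k] obtain s v where s: "s \<preceq> a" "fmlookup s (0, j) = Some k"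
        "(j, k, v, s) \<in> V'" "\<And>i m y. i \<in> R \<Longrightarrow> fmlookup r (\<rho> i, m) = Some y \<Longrightarrow> fmlookup s (i, m) = Some y"
        by blast
      \<comment> \<open>The root part of \<open>s\<close> can be added to \<open>r\<close> because
        \<open>s\<close> already extends \<open>r\<close> on the root.\<close>
      define f where "f = fmfilter (\<lambda>(x, m). x \<in> \<rho> ` R) (push (e \<xi>) s)"
      have f: "fmlookup f (\<rho> i, m) = fmlookup s (i, m)" if "i \<in> R" for i m
        using that fmlookup_push_at[OF e(1)[OF \<xi>(1)], of s i m] \<xi>(3)[OF that] by (simp add: f_def)
      have f': "fmlookup f (x, m) = None" if "x \<notin> \<rho> ` R" for x m
        using that by (simp add: f_def)
      have "compat r f"
        unfolding compat_def
      proof (intro allI impI)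
        fix x m y z assume *: "fmlookup r (x, m) = Some y" "fmlookup f (x, m) = Some z"
        then obtain i where "i \<in> R" "x = \<rho> i" using f'[of x m] by fastforce
        with * s(4) f show "y = z" by fastforce
      qed
      hence "r ++\<^sub>f f \<preceq> r" by (rule fmadd_stronger1)
      moreover have "T j k v (r ++\<^sub>f f)"
        unfolding T_def using s(1-3) j f strongerD[OF fmadd_stronger2[of r f]]
        by (auto intro!: exI[of _ s])
      ultimately show ?thesis by blast
    qed (auto simp: T_def)
  next
    fix q' :: "'c cond" and u :: "'c set" assume q': "q' \<preceq> p" and u: "countable u"
    \<comment> \<open>A member fresh for \<open>u\<close> and \<open>q'\<close>. Its support
      receives a copy of \<open>b\<close>, so that \<open>V \<zeta>\<close> is read on the side of
      \<open>b\<close>, while \<open>T\<close> is read on the side of \<open>a\<close>.\<close>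
    obtain \<zeta> where \<zeta>: "\<zeta> \<in> K" "\<tau> \<zeta> = t" "\<And>i. i \<in> R \<Longrightarrow> e \<zeta> i = \<rho> i"
        "\<And>i. i \<notin> R \<Longrightarrow> e \<zeta> i \<notin> u \<union> fst ` fmdom' q'"
      using root[of "u \<union> fst ` fmdom' q'"] u by (auto simp: countable_finite)
    define s where "s = q' ++\<^sub>f push (e \<zeta>) b"
    have "compat q' (push (e \<zeta>) b)"
      unfolding compat_def fmlookup_push_Some[OF e(1)[OF \<zeta>(1)]]
    proof clarify
      fix i m y z assume *: "fmlookup q' (e \<zeta> i, m) = Some y" "fmlookup b (i, m) = Some z"
      hence "e \<zeta> i \<in> fst ` fmdom' q'" by (force simp: fmlookup_dom'_iff)
      hence i: "i \<in> R" using \<zeta>(4)[of i] by (metis UnCI)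
      have "fmlookup q' (\<rho> i, m) = Some z" using p_lookup[OF q' i] b_ok(2)[OF i] *(2) by simp
      thus "y = z" using *(1) \<zeta>(3)[OF i] by simp
    qed
    hence s: "s \<preceq> q'" "s \<preceq> push (e \<zeta>) b"
      by (simp_all add: s_def fmadd_stronger1 fmadd_stronger2)
    have "s \<preceq> q \<zeta>"
      unfolding type(2)[OF \<zeta>(1,2)] using s(2) push_stronger[OF e(1)[OF \<zeta>(1)] bc] stronger_trans by blast
    moreover have "\<alpha> \<zeta> \<notin> u" using \<zeta>(4)[OF \<open>0 \<notin> R\<close>] e(2)[OF \<zeta>(1)] by simp
    moreover have "v = v'" if j: "n1 \<le> j" and r: "r \<preceq> s" "fmlookup r (\<alpha> \<zeta>, j) = Some k" "V \<zeta> j k v r" "T j k v' r"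
      for j k v v' r
    proof -
      define s2 where "s2 = pull (e \<zeta>) r"
      have s2: "s2 \<preceq> b" "fmlookup s2 (0, j) = Some k"
        using r(1,2) s(2) stronger_trans e(1)[OF \<zeta>(1)] e(2)[OF \<zeta>(1)]
        by (auto simp: s2_def fmlookup_pull simp flip: push_stronger_iff)
      \<comment> \<open>The value has to be decided within the support of \<open>\<zeta>\<close>,
        which takes a further strengthening. The value \<open>w\<close> found there equals
        \<open>v\<close> by uniqueness and \<open>v'\<close> by \<open>agree\<close>.\<close>
      obtain s' w where s': "s' \<preceq> s2" "(j, k, w, s') \<in> V'"
        using total'[OF stronger_trans[OF s2(1) bc] s2(2)] by blast
      have "compat r (push (e \<zeta>) s')"
        using push_compat[OF e(1)[OF \<zeta>(1)]] s'(1) by (simp add: s2_def)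
      hence r': "r ++\<^sub>f push (e \<zeta>) s' \<preceq> r" "r ++\<^sub>f push (e \<zeta>) s' \<preceq> push (e \<zeta>) s'"
        by (simp_all add: fmadd_stronger1 fmadd_stronger2)
      have "V \<zeta> j k w (r ++\<^sub>f push (e \<zeta>) s')"
        using s'(2) type(1)[OF \<zeta>(1,2)] r'(2) mono by blast
      moreover have "V \<zeta> j k v (r ++\<^sub>f push (e \<zeta>) s')" using r(3) r'(1) mono by blast
      moreover have "r ++\<^sub>f push (e \<zeta>) s' \<preceq> q \<zeta>" using r'(1) r(1) \<open>s \<preceq> q \<zeta>\<close> stronger_trans by blast
      ultimately have "v = w" using unique[OF \<zeta>(1)] by blast
      obtain s1 where s1: "s1 \<preceq> a" "fmlookup s1 (0, j) = Some k" "(j, k, v', s1) \<in> V'"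
          "\<And>i m y. i \<in> R \<Longrightarrow> fmlookup s1 (i, m) = Some y \<Longrightarrow> fmlookup r (\<rho> i, m) = Some y"
        using r(4) j unfolding T_def by auto
      have "v' = w"
      proof (rule agree[OF s1(1) stronger_trans[OF s'(1) s2(1)] s1(2) strongerD[OF s'(1) s2(2)] j s1(3) s'(2)])
        fix i m y z assume *: "i \<in> R" "fmlookup s1 (i, m) = Some y" "fmlookup s' (i, m) = Some z"
        have "fmlookup s2 (i, m) = Some y"
          using s1(4)[OF *(1,2)] \<zeta>(3)[OF *(1)] e(1)[OF \<zeta>(1)] by (simp add: s2_def fmlookup_pull)
        with *(3) show "y = z" using strongerD[OF s'(1)] by fastforce
      qed
      with \<open>v = w\<close> show ?thesis by simp
    qed
    ultimately show "\<exists>\<xi>\<in>K. \<exists>s n. s \<preceq> q' \<and> s \<preceq> q \<xi> \<and> \<alpha> \<xi> \<notin> u \<and>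
      (\<forall>j k v v' r. n \<le> j \<longrightarrow> r \<preceq> s \<longrightarrow> fmlookup r (\<alpha> \<xi>, j) = Some k \<longrightarrow> V \<xi> j k v r \<longrightarrow>
        T j k v' r \<longrightarrow> v = v')"
      using \<zeta>(1) s(1) by blast
  qed
qed

section \<open>Names over an index set above the continuum\<close>

lemma card_of_UN_le:
  assumes "infinite B" "|J| \<le>o |B|" "\<And>i. i \<in> J \<Longrightarrow> |A i| \<le>o |B|"
  shows "|\<Union>i\<in>J. A i| \<le>o |B|"
  using card_of_UNION_ordLeq_infinite[OF assms(1,2)] assms(3) by blast

lemma card_of_lists_le:
  fixes A :: "'a set"
  assumes "infinite A"
  shows "|lists A| \<le>o |A|"
proof -
  have len: "|{xs \<in> lists A. length xs = n}| \<le>o |A|" for n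
  proof (induction n)
    case 0
    have "{xs \<in> lists A. length xs = 0} = {[]}" by auto
    thus ?case using assms by (metis card_of_singl_ordLeq infinite_imp_nonempty)
  next
    case (Suc n)
    have "{xs \<in> lists A. length xs = Suc n} \<subseteq> (\<lambda>(x, xs). x # xs) ` (A \<times> {xs \<in> lists A. length xs = n})"
      by (force simp: length_Suc_conv)
    moreover have "|A \<times> {xs \<in> lists A. length xs = n}| \<le>o |A|"
      using assms Suc by (intro card_of_Times_le) (auto simp: ordIso_imp_ordLeq card_of_refl)
    ultimately show ?case
      by (meson card_of_image card_of_mono1 ordLeq_transitive)
  qed
  have "|\<Union>n\<in>UNIV. {xs \<in> lists A. length xs = n}| \<le>o |A|"
    using assms len by (intro card_of_UN_le) (auto simp: infinite_iff_card_of_nat)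
  moreover have "(\<Union>n. {xs \<in> lists A. length xs = n}) = lists A" by auto
  ultimately show ?thesis by simp
qed

lemma card_of_cond:
  assumes "infinite (UNIV :: 'c set)"
  shows "|UNIV :: 'c cond set| \<le>o |UNIV :: 'c set|"
proof -
  have nat: "|UNIV :: nat set| \<le>o |UNIV :: 'c set|"
    using assms by (simp add: infinite_iff_card_of_nat)
  have "|(UNIV \<times> UNIV) \<times> UNIV :: (('c \<times> nat) \<times> nat) set| \<le>o |UNIV :: 'c set|"
    using nat by (intro card_of_Times_le assms) (auto simp: ordIso_imp_ordLeq card_of_refl)
  hence "|UNIV :: (('c \<times> nat) \<times> nat) set| \<le>o |UNIV :: 'c set|" by simp
  moreover have "|lists (UNIV :: (('c \<times> nat) \<times> nat) set)| \<le>o |UNIV :: (('c \<times> nat) \<times> nat) set|"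
    using assms by (intro card_of_lists_le) (simp add: finite_prod)
  moreover have "|UNIV :: 'c cond set| \<le>o |lists (UNIV :: (('c \<times> nat) \<times> nat) set)|"
    using fmap_of_list_surj by (metis card_of_image lists_UNIV)
  ultimately show ?thesis by (meson ordLeq_transitive)
qed

section \<open>Evaluating names of ground objects\<close>

abbreviation nt :: "nat \<Rightarrow> ('c, 'i) name" where
  "nt n \<equiv> Check (Nat n)"

abbreviation pt :: "nat \<Rightarrow> nat \<Rightarrow> ('c, 'i) name" where
  "pt j k \<equiv> OPair (nt j) (nt k)"

text \<open>The parameter \<open>names\<close> ties the type variables \<open>'c\<close> and
  \<open>'i\<close> to the locale, so that all names in it have one type.\<close>

locale large_index =
  fixes names :: "('c \<times> 'i) itself"
  assumes beth_1_less: "beth_1 <o |UNIV :: 'c set|"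
begin

lemma infinite_index: "infinite (UNIV :: 'c set)"
proof -
  have "infinite (UNIV :: nat set set)" by (simp add: Finite_Set.finite_set)
  thus ?thesis using beth_1_less card_of_ordLeq_finite ordLess_imp_ordLeq by blast
qed

lemma nat_le_index: "|UNIV :: nat set| \<le>o |UNIV :: 'c set|"
  using infinite_index by (simp add: infinite_iff_card_of_nat)

text \<open>The summand \<open>'c\<close> of the index type of \<open>Coll\<close> has room for
  \<chi> members, whatever \<open>'i\<close> is.\<close>

lemma elems_mkset':
  fixes S :: "(('c, 'i) name \<times> 'c cond) set"
  assumes "|S| \<le>o |UNIV :: 'c set|"
  shows "elems (mkset S) = S"
proof (rule elems_mkset)
  have "|UNIV :: 'c set| \<le>o |UNIV :: ('c + 'i) set|"
    by (rule card_of_ordLeqI[of Inl]) auto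
  thus "|S| \<le>o |UNIV :: ('c + 'i) set|"
    using assms ordLeq_transitive by blast
qed

lemma countable_le_index: "countable S \<Longrightarrow> |S| \<le>o |UNIV :: 'c set|"
  by (meson UNIV_I card_of_ordLeqI countableE nat_le_index ordLeq_transitive)

text \<open>Covers the names of functions built below, whose elements pair one of countably many
  ground objects with a condition; there are at most \<chi> conditions.\<close>

lemma elems_mkset_countable_cond:
  fixes x :: "'x::countable \<Rightarrow> ('c, 'i) name" and S :: "('x \<times> 'c cond) set"
  shows "elems (mkset {(x a, p) | a p. (a, p) \<in> S}) = {(x a, p) | a p. (a, p) \<in> S}"
proof (rule elems_mkset')
  have "|UNIV :: ('x \<times> 'c cond) set| \<le>o |UNIV :: 'c set|"
    unfolding UNIV_Times_UNIV[symmetric]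
    by (intro card_of_Times_le countable_le_index card_of_cond infinite_index) auto
  moreover have "{(x a, p) | a p. (a, p) \<in> S} \<subseteq> (\<lambda>(a, p). (x a, p)) ` UNIV" by auto
  ultimately show "|{(x a, p) | a p. (a, p) \<in> S}| \<le>o |UNIV :: 'c set|"
    by (meson card_of_image card_of_mono1 ordLeq_transitive)
qed

lemma elems_check_set:
  assumes "|A| \<le>o |UNIV :: 'c set|"
  shows "elems (check_set A :: ('c, 'i) name) = (\<lambda>a. (Check a, fmempty)) ` A"
  unfolding check_set_def
  by (intro elems_mkset') (meson assms card_of_image ordLeq_transitive)

text \<open>Only \<open>Check a\<close> itself is ever forced to equal \<open>Check a\<close>, so
  membership in a check set is decided in V, independently of \<open>p\<close>.\<close>

lemma mem_check_set:
  assumes "|A| \<le>o |UNIV :: 'c set|"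
  shows "(x \<^bold>\<in> (check_set A :: ('c, 'i) name)) p \<longleftrightarrow> (\<exists>a\<in>A. x = Check a)"
proof
  assume "(x \<^bold>\<in> (check_set A :: ('c, 'i) name)) p"
  then obtain q a where "a \<in> A" "(x \<^bold>= Check a) q"
    unfolding forces_mem_def elems_check_set[OF assms] by (auto elim!: dense_belowE)
  thus "\<exists>a\<in>A. x = Check a" by auto
next
  assume "\<exists>a\<in>A. x = Check a"
  thus "(x \<^bold>\<in> (check_set A :: ('c, 'i) name)) p"
    by (auto simp: elems_check_set[OF assms] intro!: forces_memI[of _ fmempty])
qed

lemma mem_omega: "(x \<^bold>\<in> (omega :: ('c, 'i) name)) p \<longleftrightarrow> (\<exists>n. x = nt n)"
  unfolding omega_def by (subst mem_check_set) (auto intro: countable_le_index)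

lemma mem_integers: "(x \<^bold>\<in> (integers :: ('c, 'i) name)) p \<longleftrightarrow> (\<exists>v. x = Check (Integer v))"
  unfolding integers_def by (subst mem_check_set) (auto intro: countable_le_index)

lemma mem_chi: "(x \<^bold>\<in> (chi :: ('c, 'i) name)) p \<longleftrightarrow> (\<exists>\<alpha>. x = Check (Idx \<alpha>))"
  unfolding chi_def by (subst mem_check_set) (auto simp: card_of_image)

lemma mem_beth_1_plus:
  "(x \<^bold>\<in> (beth_1_plus :: ('c, 'i) name)) p \<longleftrightarrow> (\<exists>\<xi>\<in>Field (cardSuc beth_1). x = Check (Ord \<xi>))"
proof -
  have "|Field (cardSuc beth_1)| \<le>o |UNIV :: 'c set|"
    by (meson beth_1_less cardSuc_Card_order cardSuc_least card_of_Card_order card_of_Field_ordIso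
        ordIso_ordLeq_trans)
  hence "|Ord ` Field (cardSuc beth_1) :: 'c ground set| \<le>o |UNIV :: 'c set|"
    by (meson card_of_image ordLeq_transitive)
  thus ?thesis unfolding beth_1_plus_def by (subst mem_check_set) auto
qed

lemma fm_le_iff: "((x :: ('c, 'i) name) \<^bold>\<le> y) p \<longleftrightarrow> (\<exists>k m. x = nt k \<and> y = nt m \<and> k \<le> m)"
proof -
  let ?S = "{(OPair (nt k) (nt m), fmempty) | k m. k \<le> m} :: (('c, 'i) name \<times> 'c cond) set"
  have "?S \<subseteq> range (\<lambda>(k, m). (OPair (nt k) (nt m), fmempty))" by auto
  hence "countable ?S" by (rule countable_subset) auto
  hence el: "elems (le_rel :: ('c, 'i) name) = ?S"
    unfolding le_rel_def by (intro elems_mkset' countable_le_index)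
  show ?thesis
  proof
    assume "(x \<^bold>\<le> y) p"
    then obtain q k m where "k \<le> m" "(OPair x y \<^bold>= OPair (nt k) (nt m)) q"
      unfolding forces_mem_def fm_le_def el by (auto elim!: dense_belowE)
    thus "\<exists>k m. x = nt k \<and> y = nt m \<and> k \<le> m"
      by auto
  next
    assume "\<exists>k m. x = nt k \<and> y = nt m \<and> k \<le> m"
    thus "(x \<^bold>\<le> y) p"
      unfolding fm_le_def by (auto simp: el intro!: forces_memI[of _ fmempty])
  qed
qed

lemma mem_generic_fun:
  assumes "fmlookup p (\<alpha>, j) = Some m"
  shows "(OPair (OPair (Check (Idx \<alpha>)) (nt j)) (nt m) \<^bold>\<in> (generic_fun :: ('c, 'i) name)) p"
proof -
  let ?S = "{(OPair (OPair (Check (Idx \<alpha>)) (nt n)) (nt m), p)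
    | \<alpha> n m p. fmlookup p (\<alpha>, n) = Some m} :: (('c, 'i) name \<times> 'c cond) set"
  have "?S \<subseteq> (\<lambda>(\<alpha>, (n, m), p). (OPair (OPair (Check (Idx \<alpha>)) (nt n)) (nt m), p)) `
      (UNIV \<times> (UNIV :: (nat \<times> nat) set) \<times> UNIV)"
    by (auto simp: image_iff)
  moreover have "|(UNIV :: 'c set) \<times> (UNIV :: (nat \<times> nat) set) \<times> (UNIV :: 'c cond set)| \<le>o |UNIV :: 'c set|"
    by (intro card_of_Times_le[OF infinite_index ordIso_imp_ordLeq[OF card_of_refl]]
        card_of_Times_le[OF infinite_index countable_le_index] card_of_cond infinite_index) auto
  ultimately have "|?S| \<le>o |UNIV :: 'c set|"
    by (meson card_of_image card_of_mono1 ordLeq_transitive)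
  hence "elems (generic_fun :: ('c, 'i) name) = ?S"
    unfolding generic_fun_def by (rule elems_mkset')
  thus ?thesis using assms by (intro forces_memI[of _ p]) auto
qed

lemma \<omega>2_iff: "(\<^bold>\<exists>j\<^bold>:\<omega>. \<^bold>\<exists>k\<^bold>:\<omega>. (z :: ('c, 'i) name) \<^bold>= OPair j k) p \<longleftrightarrow> (\<exists>j k. z = pt j k)"
proof
  assume *: "(\<^bold>\<exists>j\<^bold>:\<omega>. \<^bold>\<exists>k\<^bold>:\<omega>. z \<^bold>= OPair j k) p"
  obtain q j where 1: "(j \<^bold>\<in> omega) q" "(\<^bold>\<exists>k\<^bold>:\<omega>. z \<^bold>= OPair j k) q" by (rule forces_bexE[OF *])
  obtain r k where 2: "(k \<^bold>\<in> omega) r" "(z \<^bold>= OPair j k) r" by (rule forces_bexE[OF 1(2)])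
  show "\<exists>j k. z = pt j k"
    using 1(1) 2 by (auto simp: mem_omega eq_OPair_iff)
next
  assume "\<exists>j k. z = pt j k"
  thus "(\<^bold>\<exists>j\<^bold>:\<omega>. \<^bold>\<exists>k\<^bold>:\<omega>. z \<^bold>= OPair j k) p"
    by (auto simp: mem_omega intro!: forces_bexI mono_fms)
qed

section \<open>Regions below graphs and forced finiteness\<close>

lemma I_E:
  fixes z :: "('c, 'i) name"
  assumes "I F z p"
  obtains q j k m where "q \<preceq> p" "z = pt j k" "F (nt j) (nt m) q" "k \<le> m"
proof -
  obtain q j where 1: "q \<preceq> p" "(j \<^bold>\<in> omega) q"
      "(\<^bold>\<exists>k\<^bold>:\<omega>. z \<^bold>= OPair j k \<^bold>\<and> (\<^bold>\<exists>m. F j m \<^bold>\<and> k \<^bold>\<le> m)) q"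
    by (rule forces_bexE[OF assms[unfolded I_def]])
  obtain r k where 2: "r \<preceq> q" "(k \<^bold>\<in> omega) r" "(z \<^bold>= OPair j k \<^bold>\<and> (\<^bold>\<exists>m. F j m \<^bold>\<and> k \<^bold>\<le> m)) r"
    by (rule forces_bexE[OF 1(3)])
  obtain s m where 3: "s \<preceq> r" "(F j m \<^bold>\<and> k \<^bold>\<le> m) s"
    using 2(3) by (auto simp: forces_and_def[of "z \<^bold>= _"] elim: forces_exE)
  obtain j' k' m' where "j = nt j'" "k = nt k'" "m = nt m'" "k' \<le> m'"
    using 1(2) 2(2) 3(2) by (auto simp: mem_omega forces_and_def fm_le_iff)
  moreover have "z = OPair j k"
    using 2(3) calculation by (auto simp: forces_and_def eq_OPair_iff)
  moreover have "s \<preceq> p" using 1 2 3 stronger_trans by blast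
  ultimately show thesis using that 3(2) by (auto simp: forces_and_def)
qed

lemma I_I:
  assumes "F (nt j) (nt m :: ('c, 'i) name) p" "k \<le> m" "\<And>j m. mono_fm (F j m)"
  shows "I F (pt j k) p"
  unfolding I_def using assms(1,2)
  by (intro forces_bexI mono_fms assms(3))
    (auto simp: mem_omega forces_and_def forces_ex_iff fm_le_iff intro!: dense_belowI'
      intro: mono_fmD[OF assms(3)])

lemma meet_graph:
  assumes "graph f (nt j) (nt a :: ('c, 'i) name) p" "graph g (nt j) (nt b) p"
  shows "meet (graph f) (graph g) (nt j) (nt (min a b)) p"
  unfolding meet_def
proof (subst forces_ex_iff, rule dense_belowI', rule exI[of _ "nt a"], subst forces_ex_iff,
    rule dense_belowI', rule exI[of _ "nt b"])
  fix q r assume "q \<preceq> p" "r \<preceq> q"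
  hence "graph f (nt j) (nt a) r" "graph g (nt j) (nt b) r"
    using assms mono_fm_graph mono_fmD by (metis stronger_trans)+
  thus "(graph f (nt j) (nt a) \<^bold>\<and> graph g (nt j) (nt b) \<^bold>\<and>
      (((nt a :: ('c, 'i) name) \<^bold>\<le> nt b \<^bold>\<and> nt (min a b) \<^bold>= (nt a :: ('c, 'i) name)) \<^bold>\<or> ((nt b :: ('c, 'i) name) \<^bold>\<le> nt a \<^bold>\<and> nt (min a b) \<^bold>= (nt b :: ('c, 'i) name)))) r"
    by (auto simp: forces_and_def forces_or_iff fm_le_iff min_def intro!: dense_belowI')
qed

text \<open>An injection of \<open>A\<close> into a natural number takes each value at one point at
  most. Settling the values one after another bounds the rows that \<open>A\<close> can
  meet.\<close>

lemma fm_finite_bound: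
  assumes "fm_finite (A :: ('c, 'i) cls) p" "\<And>z. mono_fm (A z)"
  obtains q n where "q \<preceq> p" "\<And>r j k. r \<preceq> q \<Longrightarrow> n \<le> j \<Longrightarrow> \<not> A (pt j k) r"
proof -
  obtain q0 x where q0: "q0 \<preceq> p" "(x \<^bold>\<in> omega) q0"
      "card_le A (\<lambda>m. m \<^bold>\<in> omega \<^bold>\<and> m \<^bold>\<le> x \<^bold>\<and> \<^bold>\<not> (m \<^bold>= x)) q0"
    by (rule forces_bexE[OF assms(1)[unfolded fm_finite_def]])
  then obtain N where x: "x = nt N" by (auto simp: mem_omega)
  obtain q g where q: "q \<preceq> q0" "is_fun g A (\<lambda>m. m \<^bold>\<in> omega \<^bold>\<and> m \<^bold>\<le> x \<^bold>\<and> \<^bold>\<not> (m \<^bold>= x)) q"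
    and inj: "\<And>r a a' b. r \<preceq> q \<Longrightarrow> (OPair a b \<^bold>\<in> g) r \<Longrightarrow> (OPair a' b \<^bold>\<in> g) r \<Longrightarrow>
      \<exists>s. s \<preceq> r \<and> (a \<^bold>= a') s"
    by (rule card_leE[OF q0(3)]) blast
  have "\<exists>r n. r \<preceq> q \<and> (\<forall>i<M. \<forall>s j k. s \<preceq> r \<longrightarrow> n \<le> j \<longrightarrow> \<not> (OPair (pt j k) (nt i) \<^bold>\<in> g) s)" for M
  proof (induction M)
    case (Suc M)
    then obtain r n where r: "r \<preceq> q"
      "\<And>i s j k. i < M \<Longrightarrow> s \<preceq> r \<Longrightarrow> n \<le> j \<Longrightarrow> \<not> (OPair (pt j k) (nt i) \<^bold>\<in> g) s" by blast
    \<comment> \<open>If some condition forces a point of row \<open>j\<close> to have the value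
      \<open>M\<close>, injectivity excludes all other points below it, and the rows from
      \<open>Suc j\<close> on are safe. Otherwise the value \<open>M\<close> is never taken.\<close>
    show ?case
    proof (cases "\<exists>s j k. s \<preceq> r \<and> (OPair (pt j k) (nt M) \<^bold>\<in> g) s")
      case False
      thus ?thesis using r by (metis less_Suc_eq)
    next
      case True
      then obtain s j k where s: "s \<preceq> r" "(OPair (pt j k) (nt M) \<^bold>\<in> g) s" by blast
      have "j = j'" if t: "t \<preceq> s" "(OPair (pt j' k') (nt M) \<^bold>\<in> g) t" for t j' k'
      proof -
        have "t \<preceq> q" using t(1) s(1) r(1) stronger_trans by blast
        from inj[OF this forces_mem_stronger[OF s(2) t(1)] t(2)] show ?thesis by auto
      qed
      moreover have "\<not> (OPair (pt j' k') (nt i) \<^bold>\<in> g) t" if "i < M" "t \<preceq> s" "n \<le> j'" for i t j' k'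
        using r(2)[OF that(1) _ that(3)] that(2) s(1) stronger_trans by blast
      ultimately have "\<not> (OPair (pt j' k') (nt i) \<^bold>\<in> g) t"
        if "i < Suc M" "t \<preceq> s" "max n (Suc j) \<le> j'" for i t j' k'
        using that by (metis less_Suc_eq max.bounded_iff not_less_eq_eq order_refl)
      moreover have "s \<preceq> q" using s(1) r(1) stronger_trans by blast
      ultimately show ?thesis by blast
    qed
  qed auto
  from this[of N] obtain r n where r: "r \<preceq> q"
    "\<And>i s j k. i < N \<Longrightarrow> s \<preceq> r \<Longrightarrow> n \<le> j \<Longrightarrow> \<not> (OPair (pt j k) (nt i) \<^bold>\<in> g) s" by blast
  have "\<not> A (pt j k) s" if s: "s \<preceq> r" "n \<le> j" for s j k
  proof
    assume A: "A (pt j k) s"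
    have "is_fun g A (\<lambda>m. m \<^bold>\<in> omega \<^bold>\<and> m \<^bold>\<le> x \<^bold>\<and> \<^bold>\<not> (m \<^bold>= x)) s"
      by (rule mono_fmD[OF mono_fm_is_fun q(2) stronger_trans[OF s(1) r(1)]])
    then obtain t b where t: "t \<preceq> s" "(b \<^bold>\<in> omega \<^bold>\<and> b \<^bold>\<le> x \<^bold>\<and> \<^bold>\<not> (b \<^bold>= x)) t" "(OPair (pt j k) b \<^bold>\<in> g) t"
      using A by (rule is_fun_totalE)
    then obtain i where "b = nt i" "i \<le> N" "i \<noteq> N"
      by (auto simp: forces_and_def fm_le_iff x forces_not_def)
    with r(2)[of i t j k] t s stronger_trans show False by auto
  qed
  moreover have "r \<preceq> p" using r(1) q(1) q0(1) stronger_trans by blast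
  ultimately show thesis using that by blast
qed

text \<open>A numbering \<open>h\<close> of the ground set \<open>E\<close> yields a name for an
  injection of \<open>A\<close>: a point paired with its number is contributed by exactly the
  conditions that force the point into \<open>A\<close>.\<close>

lemma fm_finiteI:
  assumes fin: "finite E" and mono: "\<And>z. mono_fm (A z)"
    and E: "\<And>z q. q \<preceq> p \<Longrightarrow> A (z :: ('c, 'i) name) q \<Longrightarrow> \<exists>(j, k)\<in>E. z = pt j k"
  shows "fm_finite A p"
proof -
  obtain h :: "nat \<times> nat \<Rightarrow> nat" where h: "inj_on h E" "h ` E \<subseteq> {..<card E}"
    using fin by (metis bij_betw_def ex_bij_betw_finite_nat order_refl atLeast0LessThan)
  let ?B = "\<lambda>m :: ('c, 'i) name. m \<^bold>\<in> omega \<^bold>\<and> m \<^bold>\<le> nt (card E) \<^bold>\<and> \<^bold>\<not> (m \<^bold>= nt (card E)) :: 'c fm"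
  define S where "S = {((j, k), q). (j, k) \<in> E \<and> A (pt j k) q}"
  define g :: "('c, 'i) name" where
    "g = mkset {((\<lambda>(j, k). OPair (pt j k) (nt (h (j, k)))) a, q) | a q. (a, q) \<in> S}"
  have el: "elems g = {((\<lambda>(j, k). OPair (pt j k) (nt (h (j, k)))) a, q) | a q. (a, q) \<in> S}"
    unfolding g_def by (rule elems_mkset_countable_cond)
  have gE: "\<exists>j k. (j, k) \<in> E \<and> x = OPair (pt j k) (nt (h (j, k))) \<and> dense_below q (A (pt j k))"
    if "(x \<^bold>\<in> g) q" for x q
  proof -
    have D: "dense_below q (\<lambda>r. \<exists>j k. (j, k) \<in> E \<and> A (pt j k) r \<and> x = OPair (pt j k) (nt (h (j, k))))"
      using that unfolding forces_mem_def el
      by (rule dense_below_weaken)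
        (auto simp: S_def eq_OPair_iff intro: mono_fmD[OF mono])
    then obtain j k where jk: "(j, k) \<in> E" "x = OPair (pt j k) (nt (h (j, k)))"
      by (auto elim!: dense_belowE)
    have "dense_below q (A (pt j k))"
      using D by (rule dense_below_weaken) (auto simp: jk)
    with jk show ?thesis by blast
  qed
  have gI: "(OPair (pt j k) (nt (h (j, k))) \<^bold>\<in> g) q" if "(j, k) \<in> E" "A (pt j k) q" for j k q
    using that by (intro forces_memI[of _ q]) (auto simp: el S_def)
  have B: "?B (nt i) q" if "i < card E" for i q
    using that by (auto simp: forces_and_def mem_omega fm_le_iff forces_not_def)
  have h': "h (j, k) < card E" if "(j, k) \<in> E" for j k using h(2) that by blast
  have "is_fun g A ?B p"
  proof (rule is_funI)
    fix z q assume "(z \<^bold>\<in> g) q"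
    then obtain j k where jk: "(j, k) \<in> E" "z = OPair (pt j k) (nt (h (j, k)))" "dense_below q (A (pt j k))"
      using gE by blast
    show "dense_below q (\<lambda>r. \<exists>a b. A a r \<and> ?B b r \<and> (z \<^bold>= OPair a b) r)"
      using jk(3) by (rule dense_below_weaken) (use B h'[OF jk(1)] jk(2) in blast)
  next
    fix a q assume q: "q \<preceq> p" "A a q"
    with E obtain j k where jk: "(j, k) \<in> E" "a = pt j k" by blast
    show "dense_below q (\<lambda>r. \<exists>b. ?B b r \<and> (OPair a b \<^bold>\<in> g) r)"
      using jk q B[OF h'[OF jk(1)]] gI[OF jk(1)] mono_fmD[OF mono]
      by (intro dense_belowI') blast
  next
    fix a b b' q assume "(OPair a b \<^bold>\<in> g) q" "(OPair a b' \<^bold>\<in> g) q"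
    from gE[OF this(1)] gE[OF this(2)] show "\<exists>r. r \<preceq> q \<and> (b \<^bold>= b') r" by auto
  qed (intro mono mono_fms)+
  moreover have "(OPair a b \<^bold>\<in> g \<^bold>\<and> OPair a' b \<^bold>\<in> g \<^bold>\<longrightarrow> a \<^bold>= a') p" for a a' b
  proof (rule forces_impI)
    fix q assume "(OPair a b \<^bold>\<in> g \<^bold>\<and> OPair a' b \<^bold>\<in> g) q"
    hence "(OPair a b \<^bold>\<in> g) q" "(OPair a' b \<^bold>\<in> g) q" by (auto simp: forces_and_def)
    from gE[OF this(1)] gE[OF this(2)] h(1) show "(a \<^bold>= a') q" by (auto dest: inj_onD)
  qed
  ultimately have "(is_fun g A ?B \<^bold>\<and>
     (\<^bold>\<forall>a. \<^bold>\<forall>a'. \<^bold>\<forall>b. OPair a b \<^bold>\<in> g \<^bold>\<and> OPair a' b \<^bold>\<in> g \<^bold>\<longrightarrow> a \<^bold>= a')) p"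
    by (auto simp: forces_and_def forces_all_def)
  hence "card_le A ?B p"
    unfolding card_le_def by (rule forces_exI) (intro mono_fms)
  thus ?thesis
    unfolding fm_finite_def by (intro forces_bexI[of _ "nt (card E)"] mono_fms) (auto simp: mem_omega)
qed

lemma is_cohen_real_graph:
  assumes "is_cohen_real (Check (Idx \<alpha>)) f p" "q \<preceq> p" "fmlookup q (\<alpha>, j) = Some m"
  obtains r where "r \<preceq> q" "(pt j m \<^bold>\<in> (f :: ('c, 'i) name)) r"
proof -
  have *: "((\<^bold>\<exists>j\<^bold>:\<omega>. \<^bold>\<exists>m\<^bold>:\<omega>. z \<^bold>= OPair j m \<^bold>\<and> OPair (OPair (Check (Idx \<alpha>)) j) m \<^bold>\<in> generic_fun) \<^bold>\<longrightarrow> z \<^bold>\<in> f) p" for z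
    using assms(1) by (auto simp: is_cohen_real_def forces_and_def forces_all_def)
  have "(\<^bold>\<exists>j'\<^bold>:\<omega>. \<^bold>\<exists>m'\<^bold>:\<omega>. pt j m \<^bold>= OPair j' m' \<^bold>\<and>
      OPair (OPair (Check (Idx \<alpha>)) j') m' \<^bold>\<in> (generic_fun :: ('c, 'i) name)) q"
    using mem_generic_fun[OF assms(3)]
    by (intro forces_bexI[of _ "nt j"] forces_bexI[of _ "nt m"] mono_fms) (auto simp: mem_omega forces_and_def)
  from forces_impD[OF *[of "pt j m"] assms(2) this] show thesis using that by blast
qed

end

section \<open>Trivializing a coherent family\<close>

context large_index
begin

lemma family_fun:
  assumes "is_family \<Phi> X p" "(f \<^bold>\<in> X) p" "(OPair f \<phi> \<^bold>\<in> (\<Phi> :: ('c, 'i) name)) p"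
  obtains r where "r \<preceq> p" "is_fun \<phi> (I (graph f)) \<Z> r"
proof -
  have "(\<^bold>\<forall>f\<^bold>:set_cls X. \<^bold>\<forall>\<phi>. OPair f \<phi> \<^bold>\<in> \<Phi> \<^bold>\<longrightarrow> is_fun \<phi> (I (graph f)) \<Z>) p"
    using assms(1) by (simp add: is_family_def forces_and_def)
  then obtain q where q: "q \<preceq> p" "(OPair f \<phi> \<^bold>\<in> \<Phi> \<^bold>\<longrightarrow> is_fun \<phi> (I (graph f)) \<Z>) q"
    using assms(2) unfolding ball_iff forces_all_def by (meson stronger_refl)
  from forces_impD[OF q(2) stronger_refl forces_mem_stronger[OF assms(3) q(1)]]
  show thesis using that q(1) stronger_trans by blast
qed

lemma coherence_bound:
  fixes f g \<phi> \<gamma> :: "('c, 'i) name"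
  assumes "coherent_1 \<Phi> X p" "(f \<^bold>\<in> X) p" "(g \<^bold>\<in> X) p" "(OPair f \<phi> \<^bold>\<in> \<Phi>) p" "(OPair g \<gamma> \<^bold>\<in> \<Phi>) p"
  obtains q n where "q \<preceq> p" "\<And>r j k. r \<preceq> q \<Longrightarrow> n \<le> j \<Longrightarrow>
    \<not> (I (meet (graph f) (graph g)) (pt j k) r \<and> differ_at \<phi> \<gamma> (pt j k) r)"
proof -
  have "(\<^bold>\<forall>f\<^bold>:set_cls X. \<^bold>\<forall>g\<^bold>:set_cls X. \<^bold>\<forall>\<phi>. \<^bold>\<forall>\<gamma>. OPair f \<phi> \<^bold>\<in> \<Phi> \<^bold>\<and> OPair g \<gamma> \<^bold>\<in> \<Phi> \<^bold>\<longrightarrow>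
     fm_finite (\<lambda>z. I (meet (graph f) (graph g)) z \<^bold>\<and> differ_at \<phi> \<gamma> z)) p"
    using assms(1) by (simp add: coherent_1_def)
  then obtain q where q: "q \<preceq> p" "(\<^bold>\<forall>g\<^bold>:set_cls X. \<^bold>\<forall>\<phi>. \<^bold>\<forall>\<gamma>. OPair f \<phi> \<^bold>\<in> \<Phi> \<^bold>\<and> OPair g \<gamma> \<^bold>\<in> \<Phi> \<^bold>\<longrightarrow>
     fm_finite (\<lambda>z. I (meet (graph f) (graph g)) z \<^bold>\<and> differ_at \<phi> \<gamma> z)) q"
    using assms(2) unfolding ball_iff[of "set_cls X" _ p] by (meson stronger_refl)
  obtain r where r: "r \<preceq> q" "(OPair f \<phi> \<^bold>\<in> \<Phi> \<^bold>\<and> OPair g \<gamma> \<^bold>\<in> \<Phi> \<^bold>\<longrightarrow>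
     fm_finite (\<lambda>z. I (meet (graph f) (graph g)) z \<^bold>\<and> differ_at \<phi> \<gamma> z)) r"
    using q(2) forces_mem_stronger[OF assms(3) q(1)] unfolding ball_iff forces_all_def
    by (meson stronger_refl)
  have rp: "r \<preceq> p" using r(1) q(1) stronger_trans by blast
  have "(OPair f \<phi> \<^bold>\<in> \<Phi> \<^bold>\<and> OPair g \<gamma> \<^bold>\<in> \<Phi>) r"
    using assms(4,5) by (simp add: forces_and_def forces_mem_stronger[OF _ rp])
  from forces_impD[OF r(2) stronger_refl this] obtain s where s: "s \<preceq> r"
    "fm_finite (\<lambda>z. I (meet (graph f) (graph g)) z \<^bold>\<and> differ_at \<phi> \<gamma> z) s" by blast
  obtain t n where t: "t \<preceq> s" "\<And>r j k. r \<preceq> t \<Longrightarrow> n \<le> j \<Longrightarrow>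
    \<not> (I (meet (graph f) (graph g)) (pt j k) \<^bold>\<and> differ_at \<phi> \<gamma> (pt j k)) r"
    by (rule fm_finite_bound[OF s(2)]) (auto intro: mono_fms)
  have "t \<preceq> p" using t(1) s(1) rp stronger_trans by blast
  thus thesis by (rule that) (use t(2) in \<open>auto simp: forces_and_def\<close>)
qed

text \<open>A point on the graph of \<open>f\<close> and not above that of \<open>g\<close> lies
  under the minimum, so coherence counts a difference of values there.\<close>

lemma disagreement:
  fixes f g \<phi> \<gamma> w :: "('c, 'i) name"
  assumes "(pt j k \<^bold>\<in> f) r" "(pt j m \<^bold>\<in> g) r" "k \<le> m"
    "(OPair (pt j k) v \<^bold>\<in> \<phi>) r" "(OPair (pt j k) w \<^bold>\<in> \<gamma>) r" "(\<^bold>\<not> (v \<^bold>= w)) r"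
  shows "I (meet (graph f) (graph g)) (pt j k) r \<and> differ_at \<phi> \<gamma> (pt j k) r"
proof
  have "meet (graph f) (graph g) (nt j) (nt (min k m)) r"
    using assms(1,2) by (intro meet_graph) (auto simp: graph_def)
  thus "I (meet (graph f) (graph g)) (pt j k) r"
    using assms(3) by (intro I_I[of _ j "min k m"] mono_fms) auto
  show "differ_at \<phi> \<gamma> (pt j k) r"
    unfolding differ_at_def using assms(4-6)
    by (intro forces_exI[of _ v] forces_exI[of _ w] mono_fms) (simp add: forces_and_def)
qed

text \<open>Once these values are decided, the rows below \<open>N\<close> of the region under
  \<open>f\<close> form a finite set of V.\<close>

lemma decide_initial_segment:
  assumes "is_fun f \<omega> \<omega> p"
  shows "\<exists>q m. q \<preceq> p \<and> (\<forall>j<N. (pt j (m j) \<^bold>\<in> (f :: ('c, 'i) name)) q)"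
proof (induction N)
  case (Suc N)
  then obtain q m where q: "q \<preceq> p" "\<forall>j<N. (pt j (m j) \<^bold>\<in> f) q" by blast
  obtain r b where r: "r \<preceq> q" "(b \<^bold>\<in> omega) r" "(OPair (nt N) b \<^bold>\<in> f) r"
    using mono_fmD[OF mono_fm_is_fun assms q(1)] by (rule is_fun_totalE[of _ _ _ _ "nt N"]) (auto simp: mem_omega)
  then obtain k where "b = nt k" by (auto simp: mem_omega)
  hence "\<forall>j<Suc N. (pt j ((m(N := k)) j) \<^bold>\<in> f) r"
    using q(2) r(3) by (auto simp: less_Suc_eq intro: forces_mem_stronger[OF _ r(1)])
  moreover have "r \<preceq> p" using r(1) q(1) stronger_trans by blast
  ultimately show ?case by blast
qed auto

text \<open>A stronger condition is enough, because a forced implication asks for its conclusion on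
  a dense set only.\<close>

lemma trivial_below:
  fixes X \<Phi> :: "('c, 'i) name"
  assumes reals: "set_of_reals X p0" and many: "contains_cohen_reals X beth_1_plus p0"
    and family: "is_family \<Phi> X p0" and coh: "coherent_1 \<Phi> X p0"
  shows "\<exists>p. p \<preceq> p0 \<and> trivial_1 \<Phi> X p"
proof -

  \<comment> \<open>Deciding the Cohen reals and their functions\<close>
  define K where "K = Field (cardSuc beth_1)"
  have K: "beth_1 <o |K|"
    unfolding K_def
    by (meson cardSuc_Card_order cardSuc_greater card_of_Card_order card_of_Field_ordIso
        ordIso_symmetric ordLess_ordIso_trans)
  let ?C = "\<lambda>\<alpha>. \<alpha> \<^bold>\<in> chi \<^bold>\<and> (\<^bold>\<exists>f\<^bold>:set_cls X. is_cohen_real \<alpha> f)"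
  obtain q0 h where q0: "q0 \<preceq> p0" "is_fun h (set_cls beth_1_plus) ?C q0"
    and h_inj: "\<And>r a a' b. r \<preceq> q0 \<Longrightarrow> (OPair a b \<^bold>\<in> h) r \<Longrightarrow> (OPair a' b \<^bold>\<in> h) r \<Longrightarrow>
      \<exists>s. s \<preceq> r \<and> (a \<^bold>= a') s"
    by (rule card_leE[OF many[unfolded contains_cohen_reals_def]]) blast
  \<comment> \<open>The condition \<open>q\<close> decides the index that \<open>h\<close> assigns
    to \<open>\<xi>\<close>, for fixed names \<open>f\<close> of that Cohen real and
    \<open>\<phi>\<close> of the family member at \<open>f\<close>.\<close>
  define good where "good \<xi> q \<alpha> f \<phi> \<longleftrightarrow> q \<preceq> q0 \<and> (OPair (Check (Ord \<xi>)) (Check (Idx \<alpha>)) \<^bold>\<in> h) q \<and>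
      (f \<^bold>\<in> X) q \<and> is_cohen_real (Check (Idx \<alpha>)) f q \<and> (OPair f \<phi> \<^bold>\<in> \<Phi>) q \<and>
      is_fun \<phi> (I (graph f)) \<Z> q" for \<xi> q \<alpha> f \<phi>
  have "\<exists>q \<alpha> f \<phi>. good \<xi> q \<alpha> f \<phi>" if \<xi>: "\<xi> \<in> K" for \<xi>
  proof -
    obtain r1 b where r1: "r1 \<preceq> q0" "?C b r1" "(OPair (Check (Ord \<xi>)) b \<^bold>\<in> h) r1"
      by (rule is_fun_totalE[OF q0(2), of "Check (Ord \<xi>)"]) (use \<xi> in \<open>auto simp: mem_beth_1_plus K_def\<close>)
    then obtain \<alpha> where \<alpha>: "b = Check (Idx \<alpha>)" by (auto simp: forces_and_def mem_chi)
    have "(\<^bold>\<exists>f\<^bold>:set_cls X. is_cohen_real b f) r1" using r1(2) by (simp add: forces_and_def)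
    then obtain r2 f where r2: "r2 \<preceq> r1" "(f \<^bold>\<in> X) r2" "is_cohen_real b f r2"
      by (rule forces_bexE)
    have r2p: "r2 \<preceq> p0" using r2(1) r1(1) q0(1) stronger_trans by blast
    have fam2: "is_family \<Phi> X r2" by (rule mono_fmD[OF mono_fm_is_family family r2p])
    hence "is_fun \<Phi> (set_cls X) univ_cls r2" by (simp add: is_family_def forces_and_def)
    then obtain r3 \<phi> where r3: "r3 \<preceq> r2" "(OPair f \<phi> \<^bold>\<in> \<Phi>) r3"
      using r2(2) by (rule is_fun_totalE) blast
    have "is_family \<Phi> X r3" by (rule mono_fmD[OF mono_fm_is_family fam2 r3(1)])
    from family_fun[OF this forces_mem_stronger[OF r2(2) r3(1)] r3(2)]
    obtain r4 where r4: "r4 \<preceq> r3" "is_fun \<phi> (I (graph f)) \<Z> r4" by blast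
    have le: "r4 \<preceq> r2" "r4 \<preceq> r1" "r4 \<preceq> q0" using r4 r3 r2 r1 stronger_trans by blast+
    have "is_cohen_real b f r4" by (rule mono_fmD[OF mono_fm_is_cohen_real r2(3) le(1)])
    hence "good \<xi> r4 \<alpha> f \<phi>"
      using le r4 r3 r2(2) r1(3) forces_mem_stronger unfolding good_def \<alpha> by blast
    thus ?thesis by blast
  qed
  then obtain q \<alpha> f \<phi> where good: "\<And>\<xi>. \<xi> \<in> K \<Longrightarrow> good \<xi> (q \<xi>) (\<alpha> \<xi>) (f \<xi>) (\<phi> \<xi>)"
    by metis
  define V where "V \<xi> j k v r \<longleftrightarrow> (OPair (pt j k) (Check (Integer v)) \<^bold>\<in> \<phi> \<xi>) r" for \<xi> j k v r
  have q: "q \<xi> \<preceq> q0" if "\<xi> \<in> K" for \<xi> using good[OF that] by (simp add: good_def)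
  have q_p0: "r \<preceq> p0" if "\<xi> \<in> K" "r \<preceq> q \<xi>" for \<xi> r
    using q[OF that(1)] that(2) q0(1) stronger_trans by blast
  have graph: "\<exists>s. s \<preceq> r \<and> (pt j k \<^bold>\<in> f \<xi>) s"
    if "\<xi> \<in> K" "r \<preceq> q \<xi>" "fmlookup r (\<alpha> \<xi>, j) = Some k" for \<xi> r j k
  proof -
    have "is_cohen_real (Check (Idx (\<alpha> \<xi>))) (f \<xi>) (q \<xi>)" using good[OF that(1)] by (simp add: good_def)
    from is_cohen_real_graph[OF this that(2,3)] show ?thesis by blast
  qed
  have mono: "V \<xi> j k v s" if "V \<xi> j k v r" "s \<preceq> r" for \<xi> j k v r s
    using that forces_mem_stronger unfolding V_def by blast
  have unique: "v = v'" if "\<xi> \<in> K" "r \<preceq> q \<xi>" "V \<xi> j k v r" "V \<xi> j k v' r" for \<xi> j k v v' r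
  proof -
    have "is_fun (\<phi> \<xi>) (I (graph (f \<xi>))) \<Z> r"
      using good[OF that(1)] that(2) mono_fmD[OF mono_fm_is_fun] unfolding good_def by blast
    from is_fun_uniqueE[OF this that(3,4)[unfolded V_def]] show ?thesis by auto
  qed
  \<comment> \<open>The condition puts \<open>(j,k)\<close> on the Cohen graph, hence into the
    domain of \<open>\<phi> \<xi>\<close>, so a stronger condition decides an integer value.\<close>
  have total: "\<exists>s v. s \<preceq> r \<and> V \<xi> j k v s"
    if \<xi>: "\<xi> \<in> K" and r: "r \<preceq> q \<xi>" "fmlookup r (\<alpha> \<xi>, j) = Some k" for \<xi> j k r
  proof -
    obtain s where s: "s \<preceq> r" "(pt j k \<^bold>\<in> f \<xi>) s" using graph[OF \<xi> r] by blast
    have I: "I (graph (f \<xi>)) (pt j k) s"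
      using s(2) by (intro I_I[of _ j k] mono_fms) (auto simp: graph_def)
    have "s \<preceq> q \<xi>" using s(1) r(1) stronger_trans by blast
    hence "is_fun (\<phi> \<xi>) (I (graph (f \<xi>))) \<Z> s"
      using good[OF \<xi>] mono_fmD[OF mono_fm_is_fun] unfolding good_def by blast
    from this I obtain t b where t: "t \<preceq> s" "(b \<^bold>\<in> integers) t" "(OPair (pt j k) b \<^bold>\<in> \<phi> \<xi>) t"
      by (rule is_fun_totalE)
    moreover obtain v where "b = Check (Integer v)" using t(2) by (auto simp: mem_integers)
    ultimately have "V \<xi> j k v t" by (simp add: V_def)
    moreover have "t \<preceq> r" using t(1) s(1) stronger_trans by blast
    ultimately show ?thesis by blast
  qed
  \<comment> \<open>A common extension makes \<open>h\<close> send both elements to the same index,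
    and \<open>h\<close> is forced to be injective.\<close>
  have inj: "\<xi> = \<eta>" if "\<xi> \<in> K" "\<eta> \<in> K" "\<alpha> \<xi> = \<alpha> \<eta>" "r \<preceq> q \<xi>" "r \<preceq> q \<eta>" for \<xi> \<eta> r
  proof -
    have "(OPair (Check (Ord \<xi>)) (Check (Idx (\<alpha> \<xi>))) \<^bold>\<in> h) r"
      using good[OF that(1)] that(4) forces_mem_stronger unfolding good_def by blast
    moreover have "(OPair (Check (Ord \<eta>)) (Check (Idx (\<alpha> \<xi>))) \<^bold>\<in> h) r"
      using good[OF that(2)] that(3,5) forces_mem_stronger unfolding good_def by metis
    moreover have "r \<preceq> q0" using that(4) q[OF that(1)] stronger_trans by blast
    ultimately show ?thesis using h_inj by fastforce
  qed
  have coherent: "\<exists>r' n. r' \<preceq> r \<and> (\<forall>j k s v v'. n \<le> j \<longrightarrow> s \<preceq> r' \<longrightarrow> fmlookup s (\<alpha> \<xi>, j) = Some k \<longrightarrow>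
        fmlookup s (\<alpha> \<eta>, j) = Some k \<longrightarrow> V \<xi> j k v s \<longrightarrow> V \<eta> j k v' s \<longrightarrow> v = v')"
    if \<xi>: "\<xi> \<in> K" and \<eta>: "\<eta> \<in> K" and r: "r \<preceq> q \<xi>" "r \<preceq> q \<eta>" for \<xi> \<eta> r
  proof -
    have "coherent_1 \<Phi> X r" by (rule mono_fmD[OF mono_fm_coherent_1 coh q_p0[OF \<xi> r(1)]])
    moreover have "(f \<xi> \<^bold>\<in> X) r" "(OPair (f \<xi>) (\<phi> \<xi>) \<^bold>\<in> \<Phi>) r" "(f \<eta> \<^bold>\<in> X) r" "(OPair (f \<eta>) (\<phi> \<eta>) \<^bold>\<in> \<Phi>) r"
      using good[OF \<xi>] good[OF \<eta>] r forces_mem_stronger unfolding good_def by blast+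
    ultimately obtain r' n where r': "r' \<preceq> r" "\<And>s j k. s \<preceq> r' \<Longrightarrow> n \<le> j \<Longrightarrow>
      \<not> (I (meet (graph (f \<xi>)) (graph (f \<eta>))) (pt j k) s \<and> differ_at (\<phi> \<xi>) (\<phi> \<eta>) (pt j k) s)"
      using coherence_bound[of \<Phi> X r "f \<xi>" "f \<eta>" "\<phi> \<xi>" "\<phi> \<eta>"] by metis
    have "v = v'" if s: "n \<le> j" "s \<preceq> r'" "fmlookup s (\<alpha> \<xi>, j) = Some k" "fmlookup s (\<alpha> \<eta>, j) = Some k"
      "V \<xi> j k v s" "V \<eta> j k v' s" for j k s v v'
    proof (rule ccontr)
      assume "v \<noteq> v'"
      have sq: "s \<preceq> q \<xi>" "s \<preceq> q \<eta>" using s(2) r'(1) r stronger_trans by blast+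
      obtain s1 where s1: "s1 \<preceq> s" "(pt j k \<^bold>\<in> f \<xi>) s1" using graph[OF \<xi> sq(1) s(3)] by blast
      have "s1 \<preceq> q \<eta>" using s1(1) sq(2) stronger_trans by blast
      then obtain s2 where s2: "s2 \<preceq> s1" "(pt j k \<^bold>\<in> f \<eta>) s2"
        using graph[OF \<eta> _ strongerD[OF s1(1) s(4)]] by blast
      have s2s: "s2 \<preceq> s" using s2(1) s1(1) stronger_trans by blast
      have "I (meet (graph (f \<xi>)) (graph (f \<eta>))) (pt j k) s2 \<and> differ_at (\<phi> \<xi>) (\<phi> \<eta>) (pt j k) s2"
        using mono[OF s(5) s2s] mono[OF s(6) s2s] \<open>v \<noteq> v'\<close>
        by (intro disagreement[OF forces_mem_stronger[OF s1(2) s2(1)] s2(2) order_refl])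
          (auto simp: V_def forces_not_def)
      moreover have "s2 \<preceq> r'" using s2s s(2) stronger_trans by blast
      ultimately show False using r'(2) s(1) by blast
    qed
    thus ?thesis using r'(1) by blast
  qed
  have "\<exists>p (T :: nat \<Rightarrow> nat \<Rightarrow> int \<Rightarrow> 'c cond \<Rightarrow> bool). p \<preceq> q0 \<and>
    (\<forall>j k v r s. T j k v r \<longrightarrow> s \<preceq> r \<longrightarrow> T j k v s) \<and>
    (\<forall>j k v v' r. r \<preceq> p \<longrightarrow> T j k v r \<longrightarrow> T j k v' r \<longrightarrow> v = v') \<and>
    (\<forall>j k r. r \<preceq> p \<longrightarrow> (\<exists>s v. s \<preceq> r \<and> T j k v s)) \<and>
    (\<forall>q' u. q' \<preceq> p \<longrightarrow> countable u \<longrightarrow> (\<exists>\<xi>\<in>K. \<exists>s n. s \<preceq> q' \<and> s \<preceq> q \<xi> \<and> \<alpha> \<xi> \<notin> u \<and>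
      (\<forall>j k v v' r. n \<le> j \<longrightarrow> r \<preceq> s \<longrightarrow> fmlookup r (\<alpha> \<xi>, j) = Some k \<longrightarrow> V \<xi> j k v r \<longrightarrow>
        T j k v' r \<longrightarrow> v = v')))"
    by (rule uniform_approximation[OF infinite_index K q inj mono unique total coherent])
  then obtain p T where p: "p \<preceq> q0" and
    T: "\<forall>j k v r s. T j k v r \<longrightarrow> s \<preceq> r \<longrightarrow> T j k v s"
      "\<forall>j k v v' r. r \<preceq> p \<longrightarrow> T j k v r \<longrightarrow> T j k v' r \<longrightarrow> v = v'"
      "\<forall>j k r. r \<preceq> p \<longrightarrow> (\<exists>s v. s \<preceq> r \<and> T j k v s)" and
    approx: "\<forall>q' u. q' \<preceq> p \<longrightarrow> countable u \<longrightarrow> (\<exists>\<xi>\<in>K. \<exists>s n. s \<preceq> q' \<and> s \<preceq> q \<xi> \<and> \<alpha> \<xi> \<notin> u \<and>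
      (\<forall>j k v v' r. n \<le> j \<longrightarrow> r \<preceq> s \<longrightarrow> fmlookup r (\<alpha> \<xi>, j) = Some k \<longrightarrow> V \<xi> j k v r \<longrightarrow>
        T j k v' r \<longrightarrow> v = v'))"
    by (elim exE conjE) (rule that)
  have T_mono: "T j k v s" if "T j k v r" "s \<preceq> r" for j k v r s
    using T(1) that by blast
  have T_unique: "v = v'" if "r \<preceq> p" "T j k v r" "T j k v' r" for j k v v' r
    using T(2) that by blast
  have T_total: "\<exists>s v. s \<preceq> r \<and> T j k v s" if "r \<preceq> p" for j k r
    using T(3) that by blast
  have p_p0: "p \<preceq> p0" using p q0(1) stronger_trans by blast

  \<comment> \<open>A name for the trivializing function\<close>
  define S where "S = {((j, k, v), r). T j k v r}"
  define \<psi> :: "('c, 'i) name" where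
    "\<psi> = mkset {((\<lambda>(j, k, v). OPair (pt j k) (Check (Integer v))) a, r) | a r. (a, r) \<in> S}"
  have el: "elems \<psi> = {((\<lambda>(j, k, v). OPair (pt j k) (Check (Integer v))) a, r) | a r. (a, r) \<in> S}"
    unfolding \<psi>_def by (rule elems_mkset_countable_cond)
  have \<psi>_I: "(OPair (pt j k) (Check (Integer v)) \<^bold>\<in> \<psi>) r" if "T j k v r" for j k v r
    using that by (intro forces_memI[of _ r]) (auto simp: el S_def)
  have \<psi>_E: "dense_below r (\<lambda>s. \<exists>j k v. x = OPair (pt j k) (Check (Integer v)) \<and> T j k v s)"
    if "(x \<^bold>\<in> \<psi>) r" for x r
    using that unfolding forces_mem_def el
    by (rule dense_below_weaken) (auto simp: S_def eq_OPair_iff intro: T_mono)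
  have "is_fun \<psi> \<omega>2 \<Z> p"
  proof (rule is_funI)
    fix z r assume "(z \<^bold>\<in> \<psi>) r"
    from \<psi>_E[OF this] show "dense_below r (\<lambda>s. \<exists>a b. \<omega>2 a s \<and> (b \<^bold>\<in> integers) s \<and> (z \<^bold>= OPair a b) s)"
      by (rule dense_below_weaken) (auto simp: \<omega>2_iff mem_integers)
  next
    fix a :: "('c, 'i) name" and r assume r: "r \<preceq> p" "\<omega>2 a r"
    then obtain j k where a: "a = pt j k" by (auto simp: \<omega>2_iff)
    show "dense_below r (\<lambda>s. \<exists>b. (b \<^bold>\<in> integers) s \<and> (OPair a b \<^bold>\<in> \<psi>) s)"
    proof (rule dense_belowI)
      fix r' assume "r' \<preceq> r"
      then obtain s v where "s \<preceq> r'" "T j k v s" using T_total r(1) stronger_trans by metis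
      thus "\<exists>s. s \<preceq> r' \<and> (\<exists>b. (b \<^bold>\<in> integers) s \<and> (OPair a b \<^bold>\<in> \<psi>) s)"
        using \<psi>_I unfolding a mem_integers by blast
    qed
  next
    fix a b b' r assume r: "r \<preceq> p" "(OPair a b \<^bold>\<in> \<psi>) r" "(OPair a b' \<^bold>\<in> \<psi>) r"
    from \<psi>_E[OF r(2)] obtain s j k v where s: "s \<preceq> r" "OPair a b = OPair (pt j k) (Check (Integer v))" "T j k v s"
      by (auto elim!: dense_belowE)
    from \<psi>_E[OF forces_mem_stronger[OF r(3) s(1)]] obtain t j' k' v' where
      t: "t \<preceq> s" "OPair a b' = OPair (pt j' k') (Check (Integer v'))" "T j' k' v' t"
      by (auto elim!: dense_belowE)
    have tr: "t \<preceq> r" using t(1) s(1) stronger_trans by blast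
    have "v = v'"
      using T_unique[OF stronger_trans[OF tr r(1)] T_mono[OF s(3) t(1)], of v'] t s by simp
    thus "\<exists>t. t \<preceq> r \<and> (b \<^bold>= b') t" using s(2) t(2) tr by auto
  qed (intro mono_fms)+

  \<comment> \<open>Finite disagreement with each member of the family\<close>
  moreover have "(\<^bold>\<forall>g\<^bold>:set_cls X. \<^bold>\<forall>\<gamma>. OPair g \<gamma> \<^bold>\<in> \<Phi> \<^bold>\<longrightarrow> fm_finite (\<lambda>z. I (graph g) z \<^bold>\<and> differ_at \<psi> \<gamma> z)) p"
  proof (rule forces_ballI, unfold forces_all_def, intro allI, rule forces_impI)
    fix g \<gamma> q1' q1
    assume q1': "q1' \<preceq> p" "(g \<^bold>\<in> X) q1'" and q1: "q1 \<preceq> q1'" "(OPair g \<gamma> \<^bold>\<in> \<Phi>) q1"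
    define D where "D z = (I (graph g) z \<^bold>\<and> differ_at \<psi> \<gamma> z)" for z
    have D_mono: "mono_fm (D z)" for z unfolding D_def by (intro mono_fms)
    have q1p: "q1 \<preceq> p" using q1(1) q1'(1) stronger_trans by blast
    have "\<exists>r. r \<preceq> q2' \<and> fm_finite D r" if q2': "q2' \<preceq> q1" for q2'
    proof (rule ccontr)
      assume inf': "\<not> (\<exists>r. r \<preceq> q2' \<and> fm_finite D r)"
      have q2'_p0: "q2' \<preceq> p0" using q2' q1p p_p0 stronger_trans by blast
      have gX: "(g \<^bold>\<in> X) q2'" using forces_mem_stronger[OF q1'(2)] q2' q1(1) stronger_trans by blast
      have "set_of_reals X q2'" by (rule mono_fmD[OF mono_fm_set_of_reals reals q2'_p0])
      then obtain q2 where q2: "q2 \<preceq> q2'" "is_fun g \<omega> \<omega> q2"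
        using gX unfolding set_of_reals_def ball_iff by (meson stronger_refl)
      have inf: "\<not> fm_finite D r" if "r \<preceq> q2" for r
        using inf' that q2(1) stronger_trans by blast
      have q2p: "q2 \<preceq> p" using q2(1) q2' q1p stronger_trans by blast
      \<comment> \<open>Otherwise, after deciding \<open>g\<close> below \<open>N\<close>, the set
        \<open>D\<close> would be confined to a finite set of V, against \<open>inf\<close>.\<close>
      have unbounded: "\<exists>r. r \<preceq> s \<and> (\<exists>j k. N \<le> j \<and> D (pt j k) r)" if s: "s \<preceq> q2" for s N
      proof (rule ccontr)
        assume none: "\<not> (\<exists>r. r \<preceq> s \<and> (\<exists>j k. N \<le> j \<and> D (pt j k) r))"
        have g_s: "is_fun g \<omega> \<omega> s" by (rule mono_fmD[OF mono_fm_is_fun q2(2) s])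
        obtain r m where r: "r \<preceq> s" "\<forall>j<N. (pt j (m j) \<^bold>\<in> g) r"
          using decide_initial_segment[OF g_s] by blast
        have "fm_finite D r"
        proof (rule fm_finiteI[of "SIGMA j:{..<N}. {..m j}"])
          fix z t assume t: "t \<preceq> r" "D z t"
          obtain t' j k k' where t': "t' \<preceq> t" "z = pt j k" "graph g (nt j) (nt k') t'" "k \<le> k'"
            using t(2) unfolding D_def forces_and_def by (auto elim: I_E)
          have ts: "t \<preceq> s" using t(1) r(1) stronger_trans by blast
          hence j: "j < N" using none t(2) t'(2) not_less by blast
          have t'r: "t' \<preceq> r" using t(1) t'(1) stronger_trans by blast
          have "is_fun g \<omega> \<omega> t'"
            by (rule mono_fmD[OF mono_fm_is_fun g_s stronger_trans[OF t'r r(1)]])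
          moreover have "(pt j (m j) \<^bold>\<in> g) t'" using r(2) j forces_mem_stronger t'r by blast
          ultimately obtain t'' where "(nt k' \<^bold>= (nt (m j) :: ('c, 'i) name)) t''"
            using t'(3) unfolding graph_def by (blast elim: is_fun_uniqueE)
          thus "\<exists>(j, k)\<in>SIGMA j:{..<N}. {..m j}. z = pt j k" using t'(2,4) j by auto
        qed (auto intro: D_mono)
        moreover have "r \<preceq> q2" using r(1) s stronger_trans by blast
        ultimately show False using inf by blast
      qed
      \<comment> \<open>\<open>ext\<close> picks conditions that force disagreements in arbitrarily
        late rows. A countable \<open>u\<close> closed under it supports the whole assumption that
        \<open>D\<close> is infinite.\<close>
      define ext where "ext s N = (SOME r. r \<preceq> s \<and> (\<exists>j k. N \<le> j \<and> D (pt j k) r))" for s N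
      have ext: "ext s N \<preceq> s \<and> (\<exists>j k. N \<le> j \<and> D (pt j k) (ext s N))" if "s \<preceq> q2" for s N
        unfolding ext_def by (rule someI_ex) (rule unbounded[OF that])
      have dom: "countable (fst ` fmdom' s)" for s :: "'c cond" by (simp add: countable_finite)
      have "countable (\<Union>N. fst ` fmdom' (ext s N))" for s
        using dom by (intro countable_UN) simp_all
      from countable_closure[of "\<lambda>s. \<Union>N. fst ` fmdom' (ext s N)", OF this dom[of q2]]
      obtain u where u: "countable u" "fst ` fmdom' q2 \<subseteq> u"
        "\<And>s. fst ` fmdom' s \<subseteq> u \<Longrightarrow> (\<Union>N. fst ` fmdom' (ext s N)) \<subseteq> u" by blast
      obtain \<xi> s n where \<xi>: "\<xi> \<in> K" "s \<preceq> q2" "s \<preceq> q \<xi>" "\<alpha> \<xi> \<notin> u" and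
        agree: "\<And>j k v v' r. n \<le> j \<Longrightarrow> r \<preceq> s \<Longrightarrow> fmlookup r (\<alpha> \<xi>, j) = Some k \<Longrightarrow> V \<xi> j k v r \<Longrightarrow>
          T j k v' r \<Longrightarrow> v = v'"
        using approx[rule_format, OF q2p u(1)] by blast
      have s_q2': "s \<preceq> q2'" using \<xi>(2) q2(1) stronger_trans by blast
      have "coherent_1 \<Phi> X s" by (rule mono_fmD[OF mono_fm_coherent_1 coh q_p0[OF \<xi>(1,3)]])
      moreover have "(f \<xi> \<^bold>\<in> X) s" "(OPair (f \<xi>) (\<phi> \<xi>) \<^bold>\<in> \<Phi>) s"
        using good[OF \<xi>(1)] \<xi>(3) forces_mem_stronger unfolding good_def by blast+
      moreover have "(g \<^bold>\<in> X) s" using forces_mem_stronger[OF gX s_q2'] .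
      moreover have "(OPair g \<gamma> \<^bold>\<in> \<Phi>) s"
        using forces_mem_stronger[OF q1(2) stronger_trans[OF s_q2' q2']] .
      ultimately obtain s' n' where s': "s' \<preceq> s" "\<And>r j k. r \<preceq> s' \<Longrightarrow> n' \<le> j \<Longrightarrow>
        \<not> (I (meet (graph (f \<xi>)) (graph g)) (pt j k) r \<and> differ_at (\<phi> \<xi>) \<gamma> (pt j k) r)"
        using coherence_bound[of \<Phi> X s "f \<xi>" g "\<phi> \<xi>" \<gamma>] by metis
      obtain N where N: "\<And>x m. N \<le> m \<Longrightarrow> fmlookup s' (x, m) = None" by (rule fmlookup_bounded) blast
      \<comment> \<open>As \<open>q2\<close> is supported by \<open>u\<close>, this part of
        \<open>s'\<close> still extends \<open>q2\<close>. Hence \<open>ext\<close> applies to it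
        and yields a condition that is again supported by \<open>u\<close>, and so compatible with
        \<open>s'\<close>.\<close>
      define s0 where "s0 = fmfilter (\<lambda>(x, m). x \<in> u) s'"
      have s0: "s0 \<preceq> q2"
        unfolding stronger_iff
      proof (intro allI impI)
        fix x m y assume *: "fmlookup q2 (x, m) = Some y"
        hence "x \<in> u" using u(2) by (force simp: fmlookup_dom'_iff)
        moreover have "fmlookup s' (x, m) = Some y"
          using strongerD[OF stronger_trans[OF s'(1) \<xi>(2)] *] .
        ultimately show "fmlookup s0 (x, m) = Some y" by (simp add: s0_def)
      qed
      \<comment> \<open>The row is past \<open>n\<close> for the agreement of
        \<open>\<phi> \<xi>\<close> with \<open>\<psi>\<close>, past \<open>n'\<close> for
        coherence, and past \<open>N\<close> so that \<open>s'\<close> is silent there.\<close>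
      define r0 where "r0 = ext s0 (max N (max n n'))"
      obtain j k where r0: "r0 \<preceq> s0" "max N (max n n') \<le> j" "D (pt j k) r0"
        using ext[OF s0, of "max N (max n n')"] unfolding r0_def by blast
      have "fst ` fmdom' s0 \<subseteq> u" by (auto simp: s0_def)
      hence r0_u: "fst ` fmdom' r0 \<subseteq> u" using u(3)[of s0] unfolding r0_def by blast
      \<comment> \<open>The genericity argument: \<open>\<alpha> \<xi>\<close> is outside
        \<open>u\<close> and \<open>j\<close> beyond \<open>N\<close>, so the Cohen real can be
        given the value \<open>k\<close> at \<open>j\<close>. This puts the disagreement point on
        its graph.\<close>
      define r1 where "r1 = fmupd (\<alpha> \<xi>, j) k (s' ++\<^sub>f r0)"
      have "compat s' r0"
        unfolding compat_def
      proof (intro allI impI)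
        fix x m y z assume *: "fmlookup s' (x, m) = Some y" "fmlookup r0 (x, m) = Some z"
        hence "x \<in> u" using r0_u by (force simp: fmlookup_dom'_iff)
        hence "fmlookup s0 (x, m) = Some y" using *(1) by (simp add: s0_def)
        thus "y = z" using strongerD[OF r0(1)] *(2) by fastforce
      qed
      hence add: "s' ++\<^sub>f r0 \<preceq> s'" "s' ++\<^sub>f r0 \<preceq> r0"
        by (simp_all add: fmadd_stronger1 fmadd_stronger2)
      have "fmlookup r0 (\<alpha> \<xi>, j) = None"
        using r0_u \<xi>(4) by (force simp: fmlookup_dom'_iff)
      moreover have "fmlookup s' (\<alpha> \<xi>, j) = None" using N r0(2) by simp
      ultimately have "r1 \<preceq> s' ++\<^sub>f r0"
        unfolding r1_def by (intro stronger_fmupd) (simp add: fmlookup_dom_iff)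
      hence r1: "r1 \<preceq> s'" "r1 \<preceq> r0" using add stronger_trans by blast+
      have r1_val: "fmlookup r1 (\<alpha> \<xi>, j) = Some k" by (simp add: r1_def)
      have D1: "I (graph g) (pt j k) r1" "differ_at \<psi> \<gamma> (pt j k) r1"
        using mono_fmD[OF D_mono r0(3) r1(2)] by (auto simp: D_def forces_and_def)
      obtain r2 k' where r2: "r2 \<preceq> r1" "(pt j k' \<^bold>\<in> g) r2" "k \<le> k'"
        using D1(1) by (auto simp: graph_def elim!: I_E)
      have differ: "differ_at \<psi> \<gamma> (pt j k) r2" by (rule mono_fmD[OF mono_fm_differ_at D1(2) r2(1)])
      obtain r2' v where r2': "r2' \<preceq> r2"
        "(\<^bold>\<exists>w. OPair (pt j k) v \<^bold>\<in> \<psi> \<^bold>\<and> OPair (pt j k) w \<^bold>\<in> \<gamma> \<^bold>\<and> \<^bold>\<not> (v \<^bold>= w)) r2'"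
        by (rule forces_exE[OF differ[unfolded differ_at_def]])
      obtain r3 w where *: "r3 \<preceq> r2'"
        "(OPair (pt j k) v \<^bold>\<in> \<psi> \<^bold>\<and> OPair (pt j k) w \<^bold>\<in> \<gamma> \<^bold>\<and> \<^bold>\<not> (v \<^bold>= w)) r3"
        by (rule forces_exE[OF r2'(2)])
      have r3: "r3 \<preceq> r2" "(OPair (pt j k) v \<^bold>\<in> \<psi>) r3" "(OPair (pt j k) w \<^bold>\<in> \<gamma>) r3" "(\<^bold>\<not> (v \<^bold>= w)) r3"
        using * r2'(1) stronger_trans by (auto simp: forces_and_def)
      from \<psi>_E[OF r3(2)] obtain r4 v0 where r4: "r4 \<preceq> r3" "v = Check (Integer v0)" "T j k v0 r4"
        by (auto elim!: dense_belowE)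
      have r4_r1: "r4 \<preceq> r1" using r4(1) r3(1) r2(1) stronger_trans by blast
      hence r4_s: "r4 \<preceq> s" using r1(1) s'(1) stronger_trans by blast
      obtain r5 v1 where r5: "r5 \<preceq> r4" "V \<xi> j k v1 r5"
        using total[OF \<xi>(1) stronger_trans[OF r4_s \<xi>(3)] strongerD[OF r4_r1 r1_val]] by blast
      have r5_s: "r5 \<preceq> s" using r5(1) r4_s stronger_trans by blast
      have r5_val: "fmlookup r5 (\<alpha> \<xi>, j) = Some k" using strongerD[OF r5(1) strongerD[OF r4_r1 r1_val]] .
      obtain r6 where r6: "r6 \<preceq> r5" "(pt j k \<^bold>\<in> f \<xi>) r6"
        using graph[OF \<xi>(1) stronger_trans[OF r5_s \<xi>(3)] r5_val] by blast
      \<comment> \<open>Here \<open>\<phi> \<xi>\<close> takes the value of \<open>\<psi>\<close>,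
        which differs from that of \<open>\<gamma>\<close>, at a point under both functions; this
        contradicts coherence.\<close>
      have "v1 = v0"
        using agree[OF _ r5_s r5_val r5(2) T_mono[OF r4(3) r5(1)]] r0(2) by simp
      hence v: "(OPair (pt j k) v \<^bold>\<in> \<phi> \<xi>) r6" using mono[OF r5(2) r6(1)] r4(2) by (simp add: V_def)
      have le: "r6 \<preceq> r3" "r6 \<preceq> r2" "r6 \<preceq> s'"
        using r6(1) r5(1) r4(1) r3(1) r4_r1 r1(1) stronger_trans by blast+
      have "I (meet (graph (f \<xi>)) (graph g)) (pt j k) r6 \<and> differ_at (\<phi> \<xi>) \<gamma> (pt j k) r6"
        by (rule disagreement[OF r6(2) forces_mem_stronger[OF r2(2) le(2)] r2(3) v
            forces_mem_stronger[OF r3(3) le(1)] forces_not_stronger[OF r3(4) le(1)]])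
      moreover have "n' \<le> j" using r0(2) by simp
      ultimately show False using s'(2)[OF le(3)] by blast
    qed
    \<comment> \<open>Forced finiteness is an existential statement, so it holds at
      \<open>q1\<close> once it holds densely below.\<close>
    hence "dense_below q1 (fm_finite D)" by (rule dense_belowI)
    hence "fm_finite D q1"
      unfolding fm_finite_def bex_iff by (rule dense_below_dense_below)
    thus "fm_finite (\<lambda>z. I (graph g) z \<^bold>\<and> differ_at \<psi> \<gamma> z) q1" by (simp add: D_def[abs_def])
  qed
  ultimately have "trivial_1 \<Phi> X p"
    unfolding trivial_1_def by (intro forces_exI[of _ \<psi>] mono_fms) (simp add: forces_and_def)
  with p_p0 show ?thesis by blast
qed

end

theorem theorem3p1:
  assumes "beth_1 <o |UNIV :: 'c set|"
  shows "\<tturnstile> (\<^bold>\<forall>X :: ('c, 'i) name.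
           set_of_reals X \<^bold>\<and> contains_cohen_reals X beth_1_plus \<^bold>\<longrightarrow>
           (\<^bold>\<forall>\<Phi>. is_family \<Phi> X \<^bold>\<and> coherent_1 \<Phi> X \<^bold>\<longrightarrow> trivial_1 \<Phi> X))"
proof -
  interpret large_index "TYPE('c \<times> 'i)" by standard (rule assms)
  have "(set_of_reals X \<^bold>\<and> contains_cohen_reals X beth_1_plus \<^bold>\<longrightarrow>
      (\<^bold>\<forall>\<Phi>. is_family \<Phi> X \<^bold>\<and> coherent_1 \<Phi> X \<^bold>\<longrightarrow> trivial_1 \<Phi> X)) p" for X :: "('c, 'i) name" and p
  proof (rule forces_impI)
    fix p1 assume X: "(set_of_reals X \<^bold>\<and> contains_cohen_reals X beth_1_plus) p1"
    have "(is_family \<Phi> X \<^bold>\<and> coherent_1 \<Phi> X \<^bold>\<longrightarrow> trivial_1 \<Phi> X) p1" for \<Phi>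
      unfolding forces_imp_iff
    proof (intro allI impI)
      fix p2 assume p2: "p2 \<preceq> p1" and \<Phi>: "(is_family \<Phi> X \<^bold>\<and> coherent_1 \<Phi> X) p2"
      have "(set_of_reals X \<^bold>\<and> contains_cohen_reals X beth_1_plus) p2"
        by (rule mono_fmD[OF mono_fm_and[OF mono_fm_set_of_reals mono_fm_contains_cohen_reals] X p2])
      with \<Phi> show "\<exists>r. r \<preceq> p2 \<and> trivial_1 \<Phi> X r"
        by (intro trivial_below) (simp_all add: forces_and_def)
    qed
    thus "(\<^bold>\<forall>\<Phi>. is_family \<Phi> X \<^bold>\<and> coherent_1 \<Phi> X \<^bold>\<longrightarrow> trivial_1 \<Phi> X) p1"
      by (simp only: forces_all_def simp_thms)
  qed
  thus ?thesis by (simp only: forced_def forces_all_def simp_thms)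
qed

end
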